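(* The existence of elementary implications in both directions (elementary equivalence) defines an equivalence relation on loop conditions $\Sigma(G\curvearrowright X)$ of finite group actions. Two loop conditions $\Sigma(G_1\curvearrowright X_1)$ and $\Sigma(G_2\curvearrowright X_2)$ are elementary equivalent if $\chi^r_\Sigma(G_2\curvearrowright X_2)=\chi^r_\Sigma(G_1\curvearrowright X_1)$. A system of representatives of the equivalence classes is given by the loop conditions of the form $$\Sigma\Big(\prod_{G'\in M}G'\curvearrowright\prod_{G'\in M}\mathbb P(G')\Big),$$ where $M$ is a finite set of finite groups (considered up to isomorphism) with trivial Frattini subgroup such that no group in $M$ has an epimorphism onto another group in $M$. The representative of the equivalence class of $\Sigma(G\curvearrowright X)$ is given by the external direct product $\prod_{G'\in\chi^r_\Sigma(G\curvearrowright X)}G'\curvearrowright\prod_{G'\in\chi^r_\Sigma(G\curvearrowright X)}\mathbb P(G')$. Moreover, $\Sigma(G\curvearrowright X)$ is elementary equivalent to the set $\{\Sigma(H\curvearrowright\mathbb P(H))\mid H\in\chi^r_\Sigma(G\curvearrowright X)\}$.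
   Context: All groups and all sets acted on are finite; a $G$-set may be empty. $\Phi(G)$ is the Frattini subgroup (intersection of all maximal subgroups; $\Phi(\{1\})=\{1\}$). $\mathbb P(G)$ is the $G$-set that is the disjoint union of all primitive $G$-sets up to isomorphism, i.e. of the coset actions $G/M$, with $M$ running over representatives of the conjugacy classes of maximal subgroups of $G$; $\mathbb P(\{1\})=\emptyset$. The external product action of $G_i\curvearrowright X_i$, $i\in I$, is the componentwise action of $\prod_iG_i$ on $\prod_iX_i$; the empty product is the trivial group acting on a single point. $\chi^r_\Sigma(H\curvearrowright Y)$ is the class of all groups isomorphic to $S/\Phi(S)$ where $S\le H$ is a subgroup such that $S\curvearrowright Y$ has no fixed point and there is no subgroup $S'\le H$ such that $S'\curvearrowright Y$ has no fixed point and there exists an epimorphism $S/\Phi(S)\to S'/\Phi(S')$ that is not an isomorphism. It contains finitely many groups up to isomorphism and is identified with a finite set of representatives when indexing products. Elementary implication. $\Sigma(H\curvearrowright Y)$ denotes the loop condition attached to a finite group action $H\curvearrowright Y$. The star product of $G\curvearrowright X$ and $H\curvearrowright Y$ is the action of $G\ltimes H^X$ on $X\times Y$ by $(g,(f_x)_x).(x,y)=(g.x,f_x.y)$ (multiplication $(g,f)(g',f')=(gg',(f_{g'.x}f'_x)_x)$). The first star power of $H\curvearrowright Y$ is itself, and the $(n+1)$-st star power, acting on $Y^{n+1}$, is the star product of the $n$-th star power with $H\curvearrowright Y$. $\Sigma(H\curvearrowright Y)$ elementary implies $\Sigma(H'\curvearrowright Y')$ if $H'\curvearrowright Y'$ can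 be obtained by: (1) taking a star power $W_n\curvearrowright Y^n$, $n\ge1$; (2) pulling it back along a (not necessarily injective) homomorphism $H_0\to W_n$; (3) replacing $H_0\curvearrowright Y^n$ by an action $H_0\curvearrowright Y'$ for which there is an $H_0$-equivariant map $Y^n\to Y'$; (4) passing to the induced action $H'\curvearrowright Y'$ along a surjective homomorphism $H_0\to H'$ whose kernel acts trivially on $Y'$. A finite set of loop conditions is treated, for elementary implications, as the loop condition of the external product of the corresponding actions; elementary equivalent means elementary implication in both directions. *)

theory Defs
  imports "HOL-Algebra.Algebra"
begin

section \<open>Maximal subgroups, the Frattini subgroup, coset actions\<close>

definition maximal_subgroup :: "'a set \<Rightarrow> ('a, 'm) monoid_scheme \<Rightarrow> bool"
  where "maximal_subgroup M G \<longleftrightarrow>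
    subgroup M G \<and> M \<noteq> carrier G \<and>
    (\<forall>N. subgroup N G \<and> M \<subseteq> N \<longrightarrow> N = M \<or> N = carrier G)"

text \<open>Intersecting with the carrier only matters for groups without maximal subgroups; it gives
  the convention that the trivial group is its own Frattini subgroup.\<close>

definition frattini :: "('a, 'm) monoid_scheme \<Rightarrow> 'a set"
  where "frattini G = carrier G \<inter> \<Inter> {M. maximal_subgroup M G}"

definition frattini_quotient :: "('a, 'm) monoid_scheme \<Rightarrow> 'a set monoid"
  where "frattini_quotient G = G Mod frattini G"

definition conjugate_in :: "('a, 'm) monoid_scheme \<Rightarrow> 'a set \<Rightarrow> 'a set \<Rightarrow> bool"
  where "conjugate_in G M N \<longleftrightarrow>
    (\<exists>g\<in>carrier G. N = g <#\<^bsub>G\<^esub> M #>\<^bsub>G\<^esub> (inv\<^bsub>G\<^esub> g))"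

definition maximal_reps :: "('a, 'm) monoid_scheme \<Rightarrow> 'a set set"
  where "maximal_reps G = (SOME R.
    (\<forall>N\<in>R. maximal_subgroup N G) \<and>
    (\<forall>M. maximal_subgroup M G \<longrightarrow> (\<exists>!N. N \<in> R \<and> conjugate_in G M N)))"

section \<open>Finite group actions\<close>

text \<open>As in the locale \<^locale>\<open>group_action\<close>, the map \<open>act A g\<close> is required to be
  extensional on \<open>pts A\<close>; this is why the constructions below restrict it explicitly.\<close>

record ('g, 'x) gaction =
  grp :: "'g monoid"
  pts :: "'x set"
  act :: "'g \<Rightarrow> 'x \<Rightarrow> 'x"

definition finite_gaction :: "('g, 'x) gaction \<Rightarrow> bool"
  where "finite_gaction A \<longleftrightarrow>
    group_action (grp A) (pts A) (act A) \<and> finite (carrier (grp A)) \<and> finite (pts A)"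

definition has_fixed_point :: "'g set \<Rightarrow> ('g, 'x) gaction \<Rightarrow> bool"
  where "has_fixed_point S A \<longleftrightarrow> (\<exists>x\<in>pts A. \<forall>g\<in>S. act A g x = x)"

text \<open>The disjoint union of all primitive \<open>G\<close>-sets up to isomorphism, as coset actions. A point is
  a left coset tagged with the maximal subgroup it belongs to.\<close>

definition prim_action :: "'g monoid \<Rightarrow> ('g, 'g set \<times> 'g set) gaction"
  where "prim_action G = (let P = Sigma (maximal_reps G) (\<lambda>M. lcosets\<^bsub>G\<^esub> M) in
    \<lparr>grp = G, pts = P, act = (\<lambda>g. \<lambda>(M, K)\<in>P. (M, g <#\<^bsub>G\<^esub> K))\<rparr>)"

definition ext_prod :: "'i set \<Rightarrow> ('i \<Rightarrow> ('g, 'x) gaction) \<Rightarrow> ('i \<Rightarrow> 'g, 'i \<Rightarrow> 'x) gaction"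
  where "ext_prod I F =
    \<lparr>grp = product_group I (\<lambda>i. grp (F i)),
     pts = (\<Pi>\<^sub>E i\<in>I. pts (F i)),
     act = (\<lambda>g. \<lambda>x\<in>(\<Pi>\<^sub>E i\<in>I. pts (F i)). \<lambda>i\<in>I. act (F i) (g i) (x i))\<rparr>"

section \<open>Star products and star powers\<close>

definition star_prod ::
    "('g, 'x) gaction \<Rightarrow> ('h, 'y) gaction \<Rightarrow> ('g \<times> ('x \<Rightarrow> 'h), 'x \<times> 'y) gaction"
  where "star_prod A B =
    \<lparr>grp =
       \<lparr>carrier = carrier (grp A) \<times> (pts A \<rightarrow>\<^sub>E carrier (grp B)),
        monoid.mult = (\<lambda>(g, f) (g', f').
          (g \<otimes>\<^bsub>grp A\<^esub> g', \<lambda>x\<in>pts A. f (act A g' x) \<otimes>\<^bsub>grp B\<^esub> f' x)),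
        one = (\<one>\<^bsub>grp A\<^esub>, \<lambda>x\<in>pts A. \<one>\<^bsub>grp B\<^esub>)\<rparr>,
     pts = pts A \<times> pts B,
     act = (\<lambda>(g, f). \<lambda>(x, y)\<in>pts A \<times> pts B. (act A g x, act B (f x) y))\<rparr>"

text \<open>Transport of an action along injective relabelings of group elements and of points.\<close>

definition relabel ::
    "('g \<Rightarrow> 'h) \<Rightarrow> ('x \<Rightarrow> 'y) \<Rightarrow> ('g, 'x) gaction \<Rightarrow> ('h, 'y) gaction"
  where "relabel a b A = (let G = grp A; a' = inv_into (carrier G) a; b' = inv_into (pts A) b in
    \<lparr>grp =
       \<lparr>carrier = a ` carrier G,
        monoid.mult = (\<lambda>u v. a (a' u \<otimes>\<^bsub>G\<^esub> a' v)),
        one = a \<one>\<^bsub>G\<^esub>\<rparr>,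
     pts = b ` pts A,
     act = (\<lambda>u. \<lambda>z\<in>b ` pts A. b (act A (a' u) (b' z)))\<rparr>)"

text \<open>The star powers of an action live on different types, so their elements are relabeled into
  common ones: a point of the \<open>n\<close>-th power is a list of length \<open>n\<close>, and \<open>Extend w f\<close> stands for
  the pair \<open>(w, f)\<close>. There is no \<open>0\<close>-th star power.\<close>

datatype ('h, 'y) star_elem = Single 'h | Extend "('h, 'y) star_elem" "'y list \<Rightarrow> 'h"

fun star_power :: "('h, 'y) gaction \<Rightarrow> nat \<Rightarrow> (('h, 'y) star_elem, 'y list) gaction"
  where
    "star_power A 0 = undefined"
  | "star_power A (Suc 0) = relabel Single (\<lambda>y. [y]) A"
  | "star_power A (Suc (Suc n)) =
       relabel (\<lambda>(w, f). Extend w f) (\<lambda>(ys, y). ys @ [y]) (star_prod (star_power A (Suc n)) A)"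

section \<open>Elementary implication\<close>

text \<open>Actions stand for their loop conditions. The auxiliary group \<open>H0\<close> ranges over groups with
  carrier in \<^typ>\<open>nat\<close>, which is no restriction since every finite group has an isomorphic
  copy there. The map \<open>\<phi>\<close> is the homomorphism along which the star power is pulled back, \<open>e\<close> is
  the equivariant map to the new set of points with action \<open>\<alpha>\<close> of \<open>H0\<close>, and \<open>\<pi>\<close> is the
  epimorphism along which \<open>\<alpha>\<close> induces the action \<open>B\<close>.\<close>

definition elem_implies :: "('h, 'y) gaction \<Rightarrow> ('k, 'z) gaction \<Rightarrow> bool"
  where "elem_implies A B \<longleftrightarrow>
    (\<exists>n\<ge>1. \<exists>(H0 :: nat monoid) \<phi> \<alpha> e \<pi>.
      group H0 \<and> finite (carrier H0) \<and>
      \<phi> \<in> hom H0 (grp (star_power A n)) \<and>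
      group_action H0 (pts B) \<alpha> \<and>
      e \<in> pts (star_power A n) \<rightarrow> pts B \<and>
      (\<forall>h\<in>carrier H0. \<forall>x\<in>pts (star_power A n).
         e (act (star_power A n) (\<phi> h) x) = \<alpha> h (e x)) \<and>
      \<pi> \<in> epi H0 (grp B) \<and>
      (\<forall>h\<in>kernel H0 (grp B) \<pi>. \<forall>z\<in>pts B. \<alpha> h z = z) \<and>
      (\<forall>h\<in>carrier H0. \<forall>z\<in>pts B. act B (\<pi> h) z = \<alpha> h z))"

definition elem_equiv :: "('h, 'y) gaction \<Rightarrow> ('k, 'z) gaction \<Rightarrow> bool"
  where "elem_equiv A B \<longleftrightarrow> elem_implies A B \<and> elem_implies B A"

definition loop_set_action ::
    "('g, 'x) gaction set \<Rightarrow> (('g, 'x) gaction \<Rightarrow> 'g, ('g, 'x) gaction \<Rightarrow> 'x) gaction"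
  where "loop_set_action L = ext_prod L (\<lambda>A. A)"

section \<open>The invariant and the representatives\<close>

text \<open>The class of all groups isomorphic to some \<open>S/\<Phi>(S)\<close> is represented by its members with
  carrier in \<^typ>\<open>nat\<close>, where every isomorphism type of finite groups occurs. Hence values of
  \<open>chi_r\<close> can be compared even for actions of different types.\<close>

definition chi_r :: "('g, 'x) gaction \<Rightarrow> nat monoid set"
  where "chi_r A = (let H = grp A; Q = (\<lambda>S. frattini_quotient (H\<lparr>carrier := S\<rparr>)) in
    {K. group K \<and>
      (\<exists>S. subgroup S H \<and> \<not> has_fixed_point S A \<and>
        \<not> (\<exists>S'. subgroup S' H \<and> \<not> has_fixed_point S' A \<and>
             (\<exists>f \<in> epi (Q S) (Q S'). f \<notin> iso (Q S) (Q S'))) \<and>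
        K \<cong> Q S)})"

definition iso_reps :: "'g monoid set \<Rightarrow> 'g monoid set \<Rightarrow> bool"
  where "iso_reps C M \<longleftrightarrow> M \<subseteq> C \<and> (\<forall>K\<in>C. \<exists>!K'. K' \<in> M \<and> K \<cong> K')"

definition same_up_to_iso :: "'g monoid set \<Rightarrow> 'g monoid set \<Rightarrow> bool"
  where "same_up_to_iso M N \<longleftrightarrow>
    (\<forall>K\<in>M. \<exists>L\<in>N. K \<cong> L) \<and> (\<forall>L\<in>N. \<exists>K\<in>M. L \<cong> K)"

text \<open>Isomorphisms are epimorphisms, so the last condition also says that distinct members of
  \<open>M\<close> are non-isomorphic: \<open>M\<close> is a set of groups up to isomorphism.\<close>

definition admissible :: "'g monoid set \<Rightarrow> bool"
  where "admissible M \<longleftrightarrow>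
    finite M \<and>
    (\<forall>K\<in>M. group K \<and> finite (carrier K) \<and> frattini K = {\<one>\<^bsub>K\<^esub>}) \<and>
    (\<forall>K\<in>M. \<forall>L\<in>M. K \<noteq> L \<longrightarrow> epi K L = {})"

definition rep_action ::
    "'g monoid set \<Rightarrow> ('g monoid \<Rightarrow> 'g, 'g monoid \<Rightarrow> 'g set \<times> 'g set) gaction"
  where "rep_action M = ext_prod M prim_action"

end

theory Submission
  imports Defs
begin

text \<open>
  Call a group \<open>T\<close> covered by an action \<open>A\<close> if it has an epimorphism onto \<open>S/\<Phi>(S)\<close> for some subgroup
  \<open>S\<close> of the group of \<open>A\<close> that is fixed-point free, which means here that no point is fixed by all
  elements of \<open>S\<close>. The key result is \<open>elem_implies_iff_covers\<close>: the action \<open>A\<close> elementary implies \<open>B\<close>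
  if and only if \<open>A\<close> covers every fixed-point free subgroup of the group of \<open>B\<close>. Equivalently, every
  group covered by \<open>B\<close> is covered by \<open>A\<close>. Reflexivity, transitivity and the classification then become
  statements about classes of covered groups.

  For the forward direction, let \<open>T\<close> be a fixed-point free subgroup of \<open>B\<close>, and let \<open>U\<close> be a minimal
  subgroup of the auxiliary group that maps onto \<open>T\<close>; the kernel of this map lies in \<open>\<Phi>(U)\<close>
  (\<open>frattini_cover\<close>). As the map from the star power is equivariant, \<open>U\<close> has no fixed point on the star
  power. Descending along the star products, the first level on which \<open>U\<close> has no fixed point provides
  a homomorphism from \<open>U\<close> onto a fixed-point free subgroup \<open>S\<close> of \<open>A\<close> (\<open>star_power_reflect\<close>). The
  resulting map from \<open>U\<close> to \<open>S/\<Phi>(S)\<close> kills \<open>\<Phi>(U)\<close> and factors through \<open>T\<close>.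

  For the converse, one builds actions of groups \<open>H\<close> on the star powers of \<open>A\<close> together with
  epimorphisms from \<open>H\<close> onto the group of \<open>B\<close>, and looks at the images \<open>T\<close> of the point stabilizers.
  If \<open>T\<close> has no fixed point, it has an epimorphism onto some \<open>S/\<Phi>(S)\<close>. The stabilizer is replaced by
  the fibre product with \<open>S\<close>, and the extension and its map to \<open>S\<close> are induced to \<open>H\<close> and to the next
  star power by means of a cocycle for the action. Elements of \<open>\<Phi>(S)\<close> are non-generators, so a subgroup
  of the fibre product that still maps onto \<open>T\<close> also maps onto \<open>S\<close> and fixes no point. Hence the new
  stabilizers have strictly smaller images (\<open>refine_stabilizers\<close>). In the end all images of stabilizers
  have fixed points, and then there is an equivariant map to the points of \<open>B\<close>.

  Finally, \<open>A\<close> covers \<open>T\<close> if and only if \<open>T\<close> maps onto a group in the invariant of \<open>A\<close>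
  (\<open>covers_iff_chi_r\<close>): among the Frattini quotients of fixed-point free subgroups that \<open>T\<close> maps onto,
  one of smallest order belongs to the invariant, up to isomorphism. A proper subgroup of \<open>G\<close> lies in
  a maximal one and hence fixes a point of the union of the primitive actions, whereas \<open>G\<close> itself fixes none. So a product of such unions for
  groups with trivial Frattini subgroup covers \<open>T\<close> if and only if \<open>T\<close> maps onto one of the factors
  (\<open>covers_ext_prod_prim_action\<close>). Comparing the two descriptions yields the representatives and their
  uniqueness.
\<close>

section \<open>Homomorphisms and finite groups\<close>

lemma representatives_exist:
  assumes "equiv U r"
  shows "\<exists>R. R \<subseteq> U \<and> (\<forall>x\<in>U. \<exists>!y. y \<in> R \<and> (x, y) \<in> r)"
proof -
  define p where "p C = (SOME y. y \<in> C)" for C :: "'a set"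
  have p: "p C \<in> C" if C: "C \<in> U // r" for C
    using in_quotient_imp_non_empty[OF assms C] unfolding p_def by (simp add: some_in_eq)
  show ?thesis
  proof (intro exI[of _ "p ` (U // r)"] conjI ballI)
    show "p ` (U // r) \<subseteq> U" using p in_quotient_imp_subset[OF assms] by blast
    fix x assume x: "x \<in> U"
    have C: "r `` {x} \<in> U // r" using x by (rule quotientI)
    show "\<exists>!y. y \<in> p ` (U // r) \<and> (x, y) \<in> r"
    proof (rule ex1I[of _ "p (r `` {x})"])
      show "p (r `` {x}) \<in> p ` (U // r) \<and> (x, p (r `` {x})) \<in> r" using p[OF C] C by blast
      fix y assume y: "y \<in> p ` (U // r) \<and> (x, y) \<in> r"
      then obtain D where D: "D \<in> U // r" "y = p D" by blast
      have "y \<in> D" "y \<in> r `` {x}" using p[OF D(1)] D(2) y by auto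
      then have "D = r `` {x}" using quotient_disj[OF assms D(1) C] by blast
      then show "y = p (r `` {x})" using D(2) by simp
    qed
  qed
qed

lemma finite_closed_imp_subgroup:
  fixes G (structure)
  assumes "group G" "finite (carrier G)" "H \<subseteq> carrier G" "H \<noteq> {}"
    and closed: "\<And>x y. x \<in> H \<Longrightarrow> y \<in> H \<Longrightarrow> x \<otimes>\<^bsub>G\<^esub> y \<in> H"
  shows "subgroup H G"
proof -
  interpret group G by fact
  have fin: "finite H" using assms(2,3) finite_subset by blast
  \<comment> \<open>Left multiplication by an element of \<open>H\<close> is injective, hence surjective, on \<open>H\<close>.\<close>
  have surj: "\<exists>y\<in>H. h \<otimes> y = z" if h: "h \<in> H" and z: "z \<in> H" for h z
  proof -
    have "inj_on (\<lambda>y. h \<otimes> y) H"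
      using assms(3) h by (auto simp: inj_on_def subset_iff)
    then have "(\<lambda>y. h \<otimes> y) ` H = H"
      by (intro card_subset_eq[OF fin]) (auto simp: closed h card_image)
    then show ?thesis using z by (metis imageE)
  qed
  have one: "\<one> \<in> H"
  proof -
    obtain h where h: "h \<in> H" using assms(4) by blast
    obtain y where "y \<in> H" "h \<otimes> y = h" using surj[OF h h] by blast
    then show ?thesis using h assms(3) by (metis l_cancel_one subsetD)
  qed
  show ?thesis
  proof (rule subgroupI)
    fix h assume h: "h \<in> H"
    obtain y where "y \<in> H" "h \<otimes> y = \<one>" using surj[OF h one] by blast
    then show "inv h \<in> H" using h assms(3) by (metis inv_comm inv_equality subsetD)
  qed (use assms in auto)
qed

lemma group_hom_iff: "group_hom G H h \<longleftrightarrow> group G \<and> group H \<and> h \<in> hom G H"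
  by (auto simp: group_hom_def group_hom_axioms_def)

lemma subgroup_preimage:
  assumes "group_hom G H h" "subgroup I H"
  shows "subgroup {x \<in> carrier G. h x \<in> I} G"
proof -
  interpret group_hom G H h by fact
  interpret I: subgroup I H by fact
  show ?thesis
    by (rule G.subgroupI) (use G.one_closed in \<open>auto intro: exI[of _ "\<one>\<^bsub>G\<^esub>"]\<close>)
qed

lemma epi_group_hom: "f \<in> epi G H \<Longrightarrow> group G \<Longrightarrow> group H \<Longrightarrow> group_hom G H f"
  by (simp add: epi_def group_hom_iff)

lemma epi_factor:
  assumes "group_hom U T h" "h ` carrier U = carrier T" "group_hom U H f"
    and ker: "kernel U T h \<subseteq> kernel U H f"
  obtains g where "g \<in> hom T H" "\<And>x. x \<in> carrier U \<Longrightarrow> g (h x) = f x"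
    "g ` carrier T = f ` carrier U"
proof -
  interpret h: group_hom U T h by fact
  interpret f: group_hom U H f by fact
  have eq: "f x = f y" if "x \<in> carrier U" "y \<in> carrier U" "h x = h y" for x y
  proof -
    have "h (x \<otimes>\<^bsub>U\<^esub> inv\<^bsub>U\<^esub> y) = h x \<otimes>\<^bsub>T\<^esub> inv\<^bsub>T\<^esub> h y" using that(1,2) by simp
    then have "h (x \<otimes>\<^bsub>U\<^esub> inv\<^bsub>U\<^esub> y) = \<one>\<^bsub>T\<^esub>" using that by simp
    then have "x \<otimes>\<^bsub>U\<^esub> inv\<^bsub>U\<^esub> y \<in> kernel U T h"
      using that(1,2) by (simp add: kernel_def del: h.hom_mult)
    then have "x \<otimes>\<^bsub>U\<^esub> inv\<^bsub>U\<^esub> y \<in> kernel U H f" using ker by blast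
    then have "f (x \<otimes>\<^bsub>U\<^esub> inv\<^bsub>U\<^esub> y) = \<one>\<^bsub>H\<^esub>" unfolding kernel_def by blast
    moreover have "f (x \<otimes>\<^bsub>U\<^esub> inv\<^bsub>U\<^esub> y) = f x \<otimes>\<^bsub>H\<^esub> inv\<^bsub>H\<^esub> f y" using that(1,2) by simp
    ultimately have "f x \<otimes>\<^bsub>H\<^esub> inv\<^bsub>H\<^esub> f y = \<one>\<^bsub>H\<^esub>" by simp
    then show ?thesis using that f.H.inv_equality[of "f x" "inv\<^bsub>H\<^esub> f y"] by simp
  qed
  define g where "g = f \<circ> inv_into (carrier U) h"
  have g: "g (h x) = f x" if "x \<in> carrier U" for x
  proof -
    have hx: "h x \<in> h ` carrier U" using that by (rule imageI)
    show ?thesis using eq[OF inv_into_into[OF hx] that f_inv_into_f[OF hx]] by (simp add: g_def)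
  qed
  have "g \<in> hom T H"
  proof (rule homI)
    fix a b assume "a \<in> carrier T" "b \<in> carrier T"
    then obtain x y where xy: "x \<in> carrier U" "y \<in> carrier U" "a = h x" "b = h y"
      using assms(2) by blast
    have "g (h (x \<otimes>\<^bsub>U\<^esub> y)) = f x \<otimes>\<^bsub>H\<^esub> f y" using xy g by (simp del: h.hom_mult)
    then show "g (a \<otimes>\<^bsub>T\<^esub> b) = g a \<otimes>\<^bsub>H\<^esub> g b" using xy g by simp
  next
    fix a assume "a \<in> carrier T"
    then obtain x where "x \<in> carrier U" "a = h x" using assms(2) by blast
    then show "g a \<in> carrier H" using g by simp
  qed
  moreover have "g ` carrier T = f ` carrier U"
    using g by (simp flip: assms(2) add: image_image)
  ultimately show thesis using g that by blast
qed

lemma epi_nonempty_trans: "epi G H \<noteq> {} \<Longrightarrow> epi H K \<noteq> {} \<Longrightarrow> epi G K \<noteq> {}"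
  using epi_compose by blast

lemma epi_between_finite_imp_iso:
  assumes "finite (carrier K)" "f \<in> epi K L" "epi L K \<noteq> {}"
  shows "f \<in> iso K L"
proof -
  obtain g where g: "g \<in> epi L K" using assms(3) by blast
  have L: "carrier L = f ` carrier K" and "carrier K = g ` carrier L"
    using assms(2) g by (auto simp: epi_def)
  then have "card (carrier K) = card (f ` carrier K)"
    using assms(1) by (metis card_image_le finite_imageI le_antisym)
  then have "inj_on f (carrier K)" using assms(1) by (simp add: eq_card_imp_inj_on)
  then show ?thesis using assms(2) by (simp add: iso_iff_mon_epi mon_def epi_def)
qed

lemma iso_imp_epi: "K \<cong> L \<Longrightarrow> epi K L \<noteq> {}"
  by (auto simp: is_iso_def iso_iff_mon_epi)

section \<open>Frattini subgroups\<close>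

lemma maximal_subgroup_preimage:
  fixes G (structure)
  assumes "group_hom G H h" "h ` carrier G = carrier H" "maximal_subgroup M H"
  shows "maximal_subgroup {x \<in> carrier G. h x \<in> M} G"
proof -
  interpret group_hom G H h by fact
  have M: "subgroup M H" "M \<noteq> carrier H"
    and Mm: "\<And>N. subgroup N H \<Longrightarrow> M \<subseteq> N \<Longrightarrow> N = M \<or> N = carrier H"
    using assms(3) by (auto simp: maximal_subgroup_def)
  let ?V = "{x \<in> carrier G. h x \<in> M}"
  have "subgroup ?V G" using subgroup_preimage[OF assms(1) M(1)] .
  moreover have "?V \<noteq> carrier G"
  proof
    assume "?V = carrier G"
    then have "h ` carrier G \<subseteq> M" by blast
    then show False using M subgroup.subset assms(2) by blast
  qed
  moreover have "N = ?V \<or> N = carrier G" if N: "subgroup N G" "?V \<subseteq> N" for N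
  proof -
    have hN: "subgroup (h ` N) H" using N(1) subgroup_img_is_subgroup by blast
    have Nsub: "N \<subseteq> carrier G" using N(1) subgroup.subset by blast
    have "M \<subseteq> h ` N"
    proof
      fix y assume y: "y \<in> M"
      then have "y \<in> carrier H" using M(1) subgroup.subset by blast
      then obtain x where "x \<in> carrier G" "y = h x" using assms(2) by blast
      then show "y \<in> h ` N" using N(2) y by blast
    qed
    then consider "h ` N = M" | "h ` N = carrier H" using Mm[OF hN] by blast
    then show ?thesis
    proof cases
      case 1
      then show ?thesis using N(2) Nsub by blast
    next
      case 2
      have "x \<in> N" if x: "x \<in> carrier G" for x
      proof -
        obtain n where n: "n \<in> N" "h x = h n" using 2 x by (metis hom_closed imageE)
        then have nc: "n \<in> carrier G" using Nsub by blast
        have "h (x \<otimes> inv n) = \<one>\<^bsub>H\<^esub>" using x nc n(2) by simp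
        then have "x \<otimes> inv n \<in> ?V" using x nc subgroup.one_closed[OF M(1)] by simp
        then have "(x \<otimes> inv n) \<otimes> n \<in> N" using subgroup.m_closed[OF N(1)] N(2) n(1) by blast
        then show ?thesis using x nc by (simp add: G.m_assoc)
      qed
      then show ?thesis using Nsub by blast
    qed
  qed
  ultimately show ?thesis unfolding maximal_subgroup_def by blast
qed

text \<open>Maximal subgroups containing the kernel of an epimorphism correspond to the maximal subgroups of
  the target. The second conclusion says that such a subgroup is the preimage of its image.\<close>

lemma maximal_subgroup_image:
  fixes G (structure)
  assumes "group_hom G H h" "h ` carrier G = carrier H" "maximal_subgroup M G"
    and ker: "kernel G H h \<subseteq> M"
  shows "maximal_subgroup (h ` M) H"
    and "\<And>x. x \<in> carrier G \<Longrightarrow> h x \<in> h ` M \<Longrightarrow> x \<in> M"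
proof -
  interpret group_hom G H h by fact
  have M: "subgroup M G" "M \<noteq> carrier G"
    and Mm: "\<And>N. subgroup N G \<Longrightarrow> M \<subseteq> N \<Longrightarrow> N = M \<or> N = carrier G"
    using assms(3) by (auto simp: maximal_subgroup_def)
  have Msub: "M \<subseteq> carrier G" using M(1) subgroup.subset by blast
  show lift: "x \<in> M" if x: "x \<in> carrier G" "h x \<in> h ` M" for x
  proof -
    obtain n where n: "n \<in> M" "h x = h n" using x(2) by blast
    then have nc: "n \<in> carrier G" using Msub by blast
    have "h (x \<otimes> inv n) = \<one>\<^bsub>H\<^esub>" using x nc n(2) by simp
    then have "x \<otimes> inv n \<in> M" using x nc ker by (auto simp: kernel_def)
    then have "(x \<otimes> inv n) \<otimes> n \<in> M" using subgroup.m_closed[OF M(1)] n(1) by blast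
    then show ?thesis using x nc by (simp add: G.m_assoc)
  qed
  have "subgroup (h ` M) H" using M(1) subgroup_img_is_subgroup by blast
  moreover have "h ` M \<noteq> carrier H"
    using lift M(2) Msub by (metis hom_closed subsetI subset_antisym)
  moreover have "K = h ` M \<or> K = carrier H" if K: "subgroup K H" "h ` M \<subseteq> K" for K
  proof -
    let ?V = "{x \<in> carrier G. h x \<in> K}"
    have "K \<subseteq> h ` carrier G" using assms(2) subgroup.subset[OF K(1)] by simp
    then have hV: "h ` ?V = K" by blast
    have "subgroup ?V G" using subgroup_preimage[OF assms(1) K(1)] .
    moreover have "M \<subseteq> ?V" using K(2) Msub by blast
    ultimately have "?V = M \<or> ?V = carrier G" using Mm by blast
    then show ?thesis using hV assms(2) by auto
  qed
  ultimately show "maximal_subgroup (h ` M) H" unfolding maximal_subgroup_def by blast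
qed

lemma frattini_subgroup:
  fixes G (structure)
  assumes "group G" shows "subgroup (frattini G) G"
proof -
  interpret group G by fact
  have "subgroup M G" if "maximal_subgroup M G" for M
    using that by (simp add: maximal_subgroup_def)
  then show ?thesis
    by (intro subgroupI)
      (auto simp: frattini_def subgroup.one_closed subgroup.m_closed subgroup.m_inv_closed
        intro!: exI[of _ \<one>])
qed

lemma frattini_image_subset:
  assumes "group_hom G H h" "h ` carrier G = carrier H"
  shows "h ` frattini G \<subseteq> frattini H"
  using maximal_subgroup_preimage[OF assms] assms(2) by (auto simp: frattini_def)

lemma frattini_normal:
  fixes G (structure)
  assumes "group G" shows "frattini G \<lhd> G"
proof -
  interpret group G by fact
  show ?thesis
  proof (rule normal_invI[OF frattini_subgroup[OF assms]])
    fix x h assume x: "x \<in> carrier G" and h: "h \<in> frattini G"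
    let ?c = "\<lambda>g. x \<otimes> g \<otimes> inv x"
    \<comment> \<open>Conjugation is a surjective endomorphism, so it preserves the Frattini subgroup.\<close>
    have hom: "group_hom G G ?c"
      unfolding group_hom_iff using x assms
      by (auto simp: hom_def m_assoc) (simp flip: m_assoc)
    have "?c ` carrier G = carrier G"
    proof
      show "carrier G \<subseteq> ?c ` carrier G"
      proof
        fix g assume g: "g \<in> carrier G"
        have "g = ?c (inv x \<otimes> g \<otimes> x)" using g x by (simp add: m_assoc) (simp flip: m_assoc)
        then show "g \<in> ?c ` carrier G" using g x by blast
      qed
    qed (use x in auto)
    from frattini_image_subset[OF hom this] show "?c h \<in> frattini G" using h by blast
  qed
qed

lemma proper_subgroup_in_maximal:
  assumes "group G" "finite (carrier G)" "subgroup U G" "U \<noteq> carrier G"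
  obtains M where "maximal_subgroup M G" "U \<subseteq> M"
proof -
  let ?F = "{N. subgroup N G \<and> U \<subseteq> N \<and> N \<noteq> carrier G}"
  have "?F \<subseteq> Pow (carrier G)" using subgroup.subset by blast
  then have "finite ?F" using assms(2) finite_subset by blast
  moreover have "?F \<noteq> {}" using assms(3,4) by blast
  ultimately have "\<exists>M\<in>?F. \<forall>N\<in>?F. M \<subseteq> N \<longrightarrow> M = N" by (rule finite_has_maximal)
  then obtain M where M: "M \<in> ?F" and mx: "\<forall>N\<in>?F. M \<subseteq> N \<longrightarrow> M = N" by (elim bexE)
  have "N = M \<or> N = carrier G" if N: "subgroup N G" "M \<subseteq> N" for N
  proof (rule disjCI)
    assume "N \<noteq> carrier G"
    then have "N \<in> ?F" using N M by auto
    then show "N = M" using mx N(2) by blast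
  qed
  then have "maximal_subgroup M G" using M by (simp add: maximal_subgroup_def)
  then show thesis using M that by simp
qed

text \<open>The Frattini subgroup consists of non-generators.\<close>

lemma frattini_nongenerator:
  fixes G (structure)
  assumes "group G" "finite (carrier G)" "subgroup U G"
    and cover: "\<And>x. x \<in> carrier G \<Longrightarrow> \<exists>u\<in>U. frattini G #>\<^bsub>G\<^esub> u = frattini G #>\<^bsub>G\<^esub> x"
  shows "U = carrier G"
proof (rule ccontr)
  interpret group G by fact
  assume "U \<noteq> carrier G"
  from proper_subgroup_in_maximal[OF assms(1-3) this]
  obtain M where M: "maximal_subgroup M G" "U \<subseteq> M" by metis
  then have Ms: "subgroup M G" "M \<noteq> carrier G" by (auto simp: maximal_subgroup_def)
  have "x \<in> M" if x: "x \<in> carrier G" for x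
  proof -
    obtain u where u: "u \<in> U" "frattini G #> u = frattini G #> x" using cover[OF x] by blast
    have "x \<in> frattini G #> u" using u x rcos_self frattini_subgroup assms(1) by metis
    then obtain p where "p \<in> frattini G" "x = p \<otimes> u" by (auto simp: r_coset_def)
    moreover have "frattini G \<subseteq> M" using M(1) by (auto simp: frattini_def)
    ultimately show ?thesis using u(1) M(2) subgroup.m_closed[OF Ms(1)] by auto
  qed
  then show False using Ms subgroup.subset by blast
qed

subsection \<open>Epimorphisms onto Frattini quotients\<close>

lemma group_frattini_quotient: "group G \<Longrightarrow> group (frattini_quotient G)"
  unfolding frattini_quotient_def by (intro normal.factorgroup_is_group frattini_normal)

lemma frattini_coset_epi:
  assumes "group G"
  shows "(\<lambda>x. frattini G #>\<^bsub>G\<^esub> x) \<in> epi G (frattini_quotient G)"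
  using normal.r_coset_hom_Mod[OF frattini_normal[OF assms]]
  by (simp add: epi_def frattini_quotient_def carrier_FactGroup)

lemma one_frattini_quotient [simp]: "\<one>\<^bsub>frattini_quotient G\<^esub> = frattini G"
  by (simp add: frattini_quotient_def)

lemma frattini_coset_eq_iff:
  assumes "group G" "x \<in> carrier G"
  shows "frattini G #>\<^bsub>G\<^esub> x = frattini G \<longleftrightarrow> x \<in> frattini G"
proof -
  interpret group G by fact
  show ?thesis using frattini_subgroup[OF assms(1)] assms(2) coset_join1 coset_join2
    by (metis subgroup.subset)
qed

lemma frattini_frattini_quotient:
  assumes "group G"
  shows "frattini (frattini_quotient G) = {\<one>\<^bsub>frattini_quotient G\<^esub>}"
proof
  let ?k = "\<lambda>x. frattini G #>\<^bsub>G\<^esub> x"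
  have epi: "?k \<in> epi G (frattini_quotient G)" using frattini_coset_epi assms .
  have hom: "group_hom G (frattini_quotient G) ?k"
    using epi assms group_frattini_quotient by (auto simp: group_hom_iff epi_def)
  have surj: "?k ` carrier G = carrier (frattini_quotient G)" using epi by (simp add: epi_def)
  show "{\<one>\<^bsub>frattini_quotient G\<^esub>} \<subseteq> frattini (frattini_quotient G)"
    using frattini_subgroup[OF group_frattini_quotient[OF assms]] subgroup.one_closed by blast
  show "frattini (frattini_quotient G) \<subseteq> {\<one>\<^bsub>frattini_quotient G\<^esub>}"
  proof
    fix c assume c: "c \<in> frattini (frattini_quotient G)"
    then obtain x where x: "x \<in> carrier G" "c = ?k x"
      using surj by (metis (no_types, lifting) frattini_def IntD1 imageE)
    have "x \<in> M" if M: "maximal_subgroup M G" for M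
    proof -
      have "kernel G (frattini_quotient G) ?k \<subseteq> M"
        using frattini_coset_eq_iff[OF assms] M by (auto simp: kernel_def frattini_def)
      note image = maximal_subgroup_image[OF hom surj M this]
      have "?k x \<in> ?k ` M" using c x image(1) by (simp add: frattini_def)
      then show ?thesis using x image(2) by blast
    qed
    then have "x \<in> frattini G" using x by (simp add: frattini_def)
    then show "c \<in> {\<one>\<^bsub>frattini_quotient G\<^esub>}"
      using x frattini_coset_eq_iff[OF assms] by simp
  qed
qed

lemma finite_frattini_quotient:
  "finite (carrier G) \<Longrightarrow> finite (carrier (frattini_quotient G))"
  by (simp add: frattini_quotient_def carrier_FactGroup)

text \<open>An epimorphism onto a group with trivial Frattini subgroup kills the Frattini subgroup.
  Therefore it makes no difference whether the source is replaced by its Frattini quotient.\<close>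

lemma epi_from_frattini_quotient_iff:
  assumes "group T" "group H" "frattini H = {\<one>\<^bsub>H\<^esub>}"
  shows "epi (frattini_quotient T) H \<noteq> {} \<longleftrightarrow> epi T H \<noteq> {}"
proof
  assume "epi (frattini_quotient T) H \<noteq> {}"
  then show "epi T H \<noteq> {}" using frattini_coset_epi[OF assms(1)] epi_compose by blast
next
  assume "epi T H \<noteq> {}"
  then obtain f where f: "f \<in> epi T H" by blast
  let ?k = "\<lambda>x. frattini T #>\<^bsub>T\<^esub> x"
  have k: "group_hom T (frattini_quotient T) ?k" "?k ` carrier T = carrier (frattini_quotient T)"
    using frattini_coset_epi assms group_frattini_quotient epi_group_hom
    by (auto simp: epi_def group_hom_iff)
  have fh: "group_hom T H f" "f ` carrier T = carrier H" using f assms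
    by (auto simp: epi_def group_hom_iff)
  have "kernel T (frattini_quotient T) ?k \<subseteq> kernel T H f"
    using frattini_image_subset[OF fh] assms(3) frattini_coset_eq_iff[OF assms(1)]
    by (auto simp: kernel_def)
  from epi_factor[OF k fh(1) this] obtain g where "g \<in> hom (frattini_quotient T) H"
    "g ` carrier (frattini_quotient T) = f ` carrier T" by metis
  then have "g \<in> epi (frattini_quotient T) H" using fh(2) by (simp add: epi_def)
  then show "epi (frattini_quotient T) H \<noteq> {}" by blast
qed

lemma frattini_trivial_iso:
  assumes "group G" "group H" "G \<cong> H" "frattini H = {\<one>\<^bsub>H\<^esub>}"
  shows "frattini G = {\<one>\<^bsub>G\<^esub>}"
proof -
  obtain f where f: "f \<in> iso G H" using assms(3) by (auto simp: is_iso_def)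
  then have fh: "group_hom G H f" "f ` carrier G = carrier H" "kernel G H f = {\<one>\<^bsub>G\<^esub>}"
    using assms by (auto simp: iso_kernel_image group_hom_iff)
  have "frattini G \<subseteq> kernel G H f"
    using frattini_image_subset[OF fh(1,2)] assms(4)
      subgroup.mem_carrier[OF frattini_subgroup[OF assms(1)]] by (auto simp: kernel_def)
  then show ?thesis
    using fh(3) subgroup.one_closed[OF frattini_subgroup[OF assms(1)]] by auto
qed

text \<open>A subgroup that is minimal among those that an epimorphism still maps onto its target meets
  the kernel in non-generators only.\<close>

lemma frattini_cover:
  fixes G (structure)
  assumes "group_hom G T p" "p ` carrier G = carrier T" "finite (carrier G)"
  obtains U where "subgroup U G" "p ` U = carrier T"
    "kernel (G\<lparr>carrier := U\<rparr>) T p \<subseteq> frattini (G\<lparr>carrier := U\<rparr>)"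
proof -
  interpret group_hom G T p by fact
  let ?P = "\<lambda>U. subgroup U G \<and> p ` U = carrier T"
  have "?P (carrier G)" using assms(2) G.subgroup_self by blast
  then obtain U where U: "?P U" and minU: "\<And>V. ?P V \<Longrightarrow> card U \<le> card V"
    using arg_min_nat_lemma[of ?P "carrier G" card] by (metis (no_types, lifting))
  have Usub: "U \<subseteq> carrier G" using U subgroup.subset by blast
  then have finU: "finite U" using assms(3) finite_subset by blast
  let ?U = "G\<lparr>carrier := U\<rparr>"
  have hU: "group_hom ?U T p" using induced_group_hom' U by blast
  have gU: "group ?U" using U by (simp add: G.subgroup_imp_group)
  have "u \<in> M" if u: "u \<in> kernel ?U T p" and M: "maximal_subgroup M ?U" for u M
  proof (rule ccontr)
    assume uM: "u \<notin> M"
    have Ms: "subgroup M ?U" and Mm: "\<And>N. subgroup N ?U \<Longrightarrow> M \<subseteq> N \<Longrightarrow> N = M \<or> N = U"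
      using M by (auto simp: maximal_subgroup_def)
    have MU: "M \<subseteq> U" "M \<noteq> U" using M subgroup.subset[OF Ms] by (auto simp: maximal_subgroup_def)
    have pM: "subgroup (p ` M) T" using group_hom.subgroup_img_is_subgroup[OF hU Ms] .
    \<comment> \<open>\<open>?N\<close> is the product of \<open>M\<close> and the kernel; maximality of \<open>M\<close> makes it all of \<open>U\<close>.\<close>
    let ?N = "{x \<in> carrier ?U. p x \<in> p ` M}"
    have "subgroup ?N ?U" using subgroup_preimage[OF hU pM] .
    moreover have "M \<subseteq> ?N" using MU by auto
    moreover have "u \<in> ?N" using u subgroup.one_closed[OF pM] by (simp add: kernel_def)
    ultimately have "?N = U" using Mm uM by blast
    then have "\<forall>x\<in>U. p x \<in> p ` M" by blast
    then have "p ` M = p ` U" using MU(1) by (simp add: image_mono image_subsetI subset_antisym)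
    then have "p ` M = carrier T" using U by simp
    moreover have "subgroup M G" using G.incl_subgroup Ms U by blast
    ultimately have "card U \<le> card M" using minU by blast
    then show False using MU finU by (meson card_seteq)
  qed
  then have "kernel ?U T p \<subseteq> frattini ?U" by (auto simp: frattini_def kernel_def)
  then show thesis using U that by blast
qed

text \<open>Let \<open>U\<close> map onto \<open>T\<close> with kernel inside the Frattini subgroup and also onto \<open>S\<close>. The map from
  \<open>U\<close> to the Frattini quotient of \<open>S\<close> kills the Frattini subgroup of \<open>U\<close>, so it descends to \<open>T\<close>.\<close>

lemma epi_frattini_quotient_of_cover:
  assumes "group_hom U T p" "p ` carrier U = carrier T" "kernel U T p \<subseteq> frattini U"
    and "group_hom U S g" "g ` carrier U = carrier S"
  shows "epi T (frattini_quotient S) \<noteq> {}"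
proof -
  let ?k = "\<lambda>x. frattini S #>\<^bsub>S\<^esub> x"
  have gr: "group U" "group T" "group S" using assms by (auto simp: group_hom_iff)
  have f: "?k \<circ> g \<in> epi U (frattini_quotient S)"
    using frattini_coset_epi[OF gr(3)] assms(4,5)
    by (intro epi_compose) (auto simp: epi_def group_hom_iff)
  have fh: "group_hom U (frattini_quotient S) (?k \<circ> g)"
    using f gr group_frattini_quotient epi_group_hom by blast
  have "kernel U T p \<subseteq> kernel U (frattini_quotient S) (?k \<circ> g)"
  proof
    fix u assume u: "u \<in> kernel U T p"
    then have "g u \<in> frattini S" "u \<in> carrier U"
      using assms(3) frattini_image_subset[OF assms(4,5)] by (auto simp: kernel_def)
    then have "frattini S #>\<^bsub>S\<^esub> g u = frattini S"
      using frattini_coset_eq_iff[OF gr(3)] by (simp add: frattini_def)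
    then show "u \<in> kernel U (frattini_quotient S) (?k \<circ> g)"
      using \<open>u \<in> carrier U\<close> by (simp add: kernel_def)
  qed
  from epi_factor[OF assms(1,2) fh this] obtain q where
    "q \<in> hom T (frattini_quotient S)" "q ` carrier T = (?k \<circ> g) ` carrier U" by metis
  then have "q \<in> epi T (frattini_quotient S)" using f by (simp add: epi_def)
  then show ?thesis by blast
qed

section \<open>Finite group actions and star powers\<close>

lemma group_actionI:
  fixes G (structure)
  assumes "group G"
    and closed: "\<And>g x. g \<in> carrier G \<Longrightarrow> x \<in> E \<Longrightarrow> \<phi> g x \<in> E"
    and one: "\<And>x. x \<in> E \<Longrightarrow> \<phi> \<one> x = x"
    and mult: "\<And>g h x. g \<in> carrier G \<Longrightarrow> h \<in> carrier G \<Longrightarrow> x \<in> E \<Longrightarrow> \<phi> (g \<otimes> h) x = \<phi> g (\<phi> h x)"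
    and ext: "\<And>g. g \<in> carrier G \<Longrightarrow> \<phi> g \<in> extensional E"
  shows "group_action G E \<phi>"
proof -
  interpret group G by fact
  have inv: "\<phi> (inv g) (\<phi> g x) = x" "\<phi> g (\<phi> (inv g) x) = x"
    if "g \<in> carrier G" "x \<in> E" for g x
    using that mult[of "inv g" g x] mult[of g "inv g" x] one by simp_all
  have bij: "\<phi> g \<in> Bij E" if g: "g \<in> carrier G" for g
  proof -
    have "bij_betw (\<phi> g) E E"
      by (rule bij_betwI[where g = "\<phi> (inv g)"]) (use g inv closed in auto)
    then show ?thesis using ext[OF g] by (simp add: Bij_def)
  qed
  have "\<phi> \<in> hom G (BijGroup E)"
  proof (rule homI)
    fix g h assume gh: "g \<in> carrier G" "h \<in> carrier G"
    have "\<phi> (g \<otimes> h) = compose E (\<phi> g) (\<phi> h)"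
      by (rule extensionalityI[where A = E]) (use gh ext mult in \<open>auto simp: compose_def\<close>)
    then show "\<phi> (g \<otimes> h) = \<phi> g \<otimes>\<^bsub>BijGroup E\<^esub> \<phi> h"
      using gh bij by (simp add: BijGroup_def)
  qed (simp add: BijGroup_def bij)
  then show ?thesis
    by (simp add: group_action_def group_hom_iff group_BijGroup assms(1))
qed

lemma finite_gactionD:
  assumes "finite_gaction A"
  shows "group (grp A)" "finite (carrier (grp A))" "finite (pts A)"
    "\<And>g x. g \<in> carrier (grp A) \<Longrightarrow> x \<in> pts A \<Longrightarrow> act A g x \<in> pts A"
    "\<And>x. x \<in> pts A \<Longrightarrow> act A \<one>\<^bsub>grp A\<^esub> x = x"
    "\<And>g h x. g \<in> carrier (grp A) \<Longrightarrow> h \<in> carrier (grp A) \<Longrightarrow> x \<in> pts A \<Longrightarrow>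
      act A (g \<otimes>\<^bsub>grp A\<^esub> h) x = act A g (act A h x)"
    "\<And>g. g \<in> carrier (grp A) \<Longrightarrow> act A g \<in> extensional (pts A)"
proof -
  interpret group_action "grp A" "pts A" "act A" using assms by (simp add: finite_gaction_def)
  show "group (grp A)" using group_hom by (simp add: group_hom_iff)
  show "finite (carrier (grp A))" "finite (pts A)" using assms by (auto simp: finite_gaction_def)
  show "act A g x \<in> pts A" if "g \<in> carrier (grp A)" "x \<in> pts A" for g x
    using element_image that by blast
  show "act A \<one>\<^bsub>grp A\<^esub> x = x" if "x \<in> pts A" for x using id_eq_one that by (metis restrict_apply')
  show "act A (g \<otimes>\<^bsub>grp A\<^esub> h) x = act A g (act A h x)"
    if "g \<in> carrier (grp A)" "h \<in> carrier (grp A)" "x \<in> pts A" for g h x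
    using composition_rule that by blast
  show "act A g \<in> extensional (pts A)" if "g \<in> carrier (grp A)" for g
    using bij_prop0[OF that] by (simp add: Bij_def)
qed

lemma has_fixed_point_mono: "has_fixed_point T A \<Longrightarrow> S \<subseteq> T \<Longrightarrow> has_fixed_point S A"
  by (auto simp: has_fixed_point_def)

subsection \<open>Relabeling\<close>

context
  fixes A :: "('g, 'x) gaction" and a :: "'g \<Rightarrow> 'h" and b :: "'x \<Rightarrow> 'y"
  assumes A: "finite_gaction A" and inj: "inj_on a (carrier (grp A))" "inj_on b (pts A)"
begin

lemma relabel_simps:
  shows "carrier (grp (relabel a b A)) = a ` carrier (grp A)"
    and "\<one>\<^bsub>grp (relabel a b A)\<^esub> = a \<one>\<^bsub>grp A\<^esub>"
    and "pts (relabel a b A) = b ` pts A"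
    and "\<And>g h. g \<in> carrier (grp A) \<Longrightarrow> h \<in> carrier (grp A) \<Longrightarrow>
      a g \<otimes>\<^bsub>grp (relabel a b A)\<^esub> a h = a (g \<otimes>\<^bsub>grp A\<^esub> h)"
    and "\<And>g x. g \<in> carrier (grp A) \<Longrightarrow> x \<in> pts A \<Longrightarrow>
      act (relabel a b A) (a g) (b x) = b (act A g x)"
    and "\<And>u. act (relabel a b A) u \<in> extensional (b ` pts A)"
  by (simp_all add: relabel_def Let_def inv_into_f_f inj)

lemma relabel_iso: "a \<in> iso (grp A) (grp (relabel a b A))"
  using inj by (auto simp: iso_def hom_def bij_betw_def relabel_simps)

lemma finite_gaction_relabel: "finite_gaction (relabel a b A)"
proof -
  note D = finite_gactionD[OF A]
  interpret group "grp A" by (rule D(1))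
  have "group (grp (relabel a b A))"
  proof (rule groupI, goal_cases)
    case (3 x y z)
    then show ?case by (auto simp: relabel_simps m_assoc)
  next
    case (5 x)
    then obtain g where g: "g \<in> carrier (grp A)" "x = a g" by (auto simp: relabel_simps)
    then show ?case by (intro bexI[of _ "a (inv\<^bsub>grp A\<^esub> g)"]) (auto simp: relabel_simps)
  qed (auto simp: relabel_simps)
  then have "group_action (grp (relabel a b A)) (pts (relabel a b A)) (act (relabel a b A))"
    by (rule group_actionI) (auto simp: relabel_simps D)
  then show ?thesis using D by (simp add: finite_gaction_def relabel_simps)
qed

lemma relabel_has_fixed_point:
  assumes "S \<subseteq> carrier (grp A)"
  shows "has_fixed_point (a ` S) (relabel a b A) \<longleftrightarrow> has_fixed_point S A"
proof -
  have "act (relabel a b A) (a g) (b x) = b x \<longleftrightarrow> act A g x = x" if "g \<in> S" "x \<in> pts A" for g x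
    using that assms finite_gactionD(4)[OF A] inj(2)
    by (subst relabel_simps) (auto simp: inj_on_eq_iff)
  then show ?thesis by (auto simp: has_fixed_point_def relabel_simps)
qed

end

subsection \<open>Star products\<close>

lemma star_prod_simps:
  shows "carrier (grp (star_prod A B)) = carrier (grp A) \<times> (pts A \<rightarrow>\<^sub>E carrier (grp B))"
    and "\<one>\<^bsub>grp (star_prod A B)\<^esub> = (\<one>\<^bsub>grp A\<^esub>, \<lambda>x\<in>pts A. \<one>\<^bsub>grp B\<^esub>)"
    and "(g, f) \<otimes>\<^bsub>grp (star_prod A B)\<^esub> (g', f') =
      (g \<otimes>\<^bsub>grp A\<^esub> g', \<lambda>x\<in>pts A. f (act A g' x) \<otimes>\<^bsub>grp B\<^esub> f' x)"
    and "pts (star_prod A B) = pts A \<times> pts B"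
    and "x \<in> pts A \<Longrightarrow> y \<in> pts B \<Longrightarrow> act (star_prod A B) (g, f) (x, y) = (act A g x, act B (f x) y)"
    and "act (star_prod A B) u \<in> extensional (pts A \<times> pts B)"
  by (auto simp: star_prod_def split: prod.splits)

lemma finite_gaction_star_prod:
  assumes "finite_gaction A" "finite_gaction B"
  shows "finite_gaction (star_prod A B)"
proof -
  note A = finite_gactionD[OF assms(1)] and B = finite_gactionD[OF assms(2)]
  interpret A: group "grp A" by (rule A(1))
  interpret B: group "grp B" by (rule B(1))
  let ?P = "star_prod A B"
  have mem: "f x \<in> carrier (grp B)" if "f \<in> pts A \<rightarrow>\<^sub>E carrier (grp B)" "x \<in> pts A" for f x
    using that by auto
  have "group (grp ?P)"
  proof (rule groupI, goal_cases)
    case (1 u v)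
    then show ?case by (cases u; cases v) (auto simp: star_prod_simps A mem)
  next
    case 2
    then show ?case by (auto simp: star_prod_simps)
  next
    case (3 u v w)
    then show ?case
      by (cases u; cases v; cases w)
        (auto simp: star_prod_simps A mem A.m_assoc B.m_assoc intro!: restrict_ext)
  next
    case (4 u)
    obtain g f where u: "u = (g, f)" by (cases u)
    then have gf: "g \<in> carrier (grp A)" "f \<in> pts A \<rightarrow>\<^sub>E carrier (grp B)"
      using 4 by (auto simp: star_prod_simps)
    then have "f \<in> extensional (pts A)" by (simp add: PiE_def)
    then have "(\<lambda>x\<in>pts A. (\<lambda>x\<in>pts A. \<one>\<^bsub>grp B\<^esub>) (act A g x) \<otimes>\<^bsub>grp B\<^esub> f x) = f"
      by (intro extensionalityI[where A = "pts A"]) (use gf in \<open>auto simp: A mem\<close>)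
    then show ?case using gf by (simp add: u star_prod_simps)
  next
    case (5 u)
    obtain g f where u: "u = (g, f)" by (cases u)
    then have gf: "g \<in> carrier (grp A)" "f \<in> pts A \<rightarrow>\<^sub>E carrier (grp B)"
      using 5 by (auto simp: star_prod_simps)
    let ?i = "inv\<^bsub>grp A\<^esub> g"
    let ?f = "\<lambda>x\<in>pts A. inv\<^bsub>grp B\<^esub> f (act A ?i x)"
    have "act A ?i (act A g x) = x" if "x \<in> pts A" for x
      using A(6)[of ?i g x] gf that by (simp add: A(5))
    then have "(?i, ?f) \<otimes>\<^bsub>grp ?P\<^esub> u = \<one>\<^bsub>grp ?P\<^esub>"
      using gf by (auto simp: u star_prod_simps A mem intro!: restrict_ext)
    moreover have "(?i, ?f) \<in> carrier (grp ?P)"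
      using gf by (auto simp: star_prod_simps A mem)
    ultimately show ?case by blast
  qed
  then have "group_action (grp ?P) (pts ?P) (act ?P)"
  proof (rule group_actionI, goal_cases)
    case (4 u)
    then show ?case by (simp add: star_prod_simps)
  qed (auto simp: star_prod_simps A B mem)
  moreover have "finite (carrier (grp ?P))" "finite (pts ?P)"
    using A(2,3) B(2,3) by (auto simp: star_prod_simps intro: finite_PiE)
  ultimately show ?thesis by (simp add: finite_gaction_def)
qed

text \<open>If the first component of a fixed-point free subgroup of a star product fixes the point
  \<open>x\<close>, then evaluating the second component at \<open>x\<close> is a homomorphism with fixed-point free image.\<close>

lemma star_prod_reflect:
  assumes "finite_gaction A" "finite_gaction B" "\<phi> \<in> hom U (grp (star_prod A B))"
    and "\<not> has_fixed_point (\<phi> ` carrier U) (star_prod A B)"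
  shows "(fst \<circ> \<phi> \<in> hom U (grp A) \<and> \<not> has_fixed_point ((fst \<circ> \<phi>) ` carrier U) A) \<or>
    (\<exists>\<psi> \<in> hom U (grp B). \<not> has_fixed_point (\<psi> ` carrier U) B)"
proof (rule disjCI)
  note A = finite_gactionD[OF assms(1)] and B = finite_gactionD[OF assms(2)]
  have mem: "fst (\<phi> u) \<in> carrier (grp A)" "snd (\<phi> u) \<in> pts A \<rightarrow>\<^sub>E carrier (grp B)"
    if "u \<in> carrier U" for u
    using hom_in_carrier[OF assms(3) that] by (auto simp: star_prod_simps)
  have mult: "\<phi> (u \<otimes>\<^bsub>U\<^esub> v) = (fst (\<phi> u) \<otimes>\<^bsub>grp A\<^esub> fst (\<phi> v),
      \<lambda>x\<in>pts A. snd (\<phi> u) (act A (fst (\<phi> v)) x) \<otimes>\<^bsub>grp B\<^esub> snd (\<phi> v) x)"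
    if "u \<in> carrier U" "v \<in> carrier U" for u v
    using hom_mult[OF assms(3) that] star_prod_simps(3)
    by (metis prod.collapse)
  have fst_hom: "fst \<circ> \<phi> \<in> hom U (grp A)"
    by (rule homI) (auto simp: mem mult)
  assume none: "\<not> (\<exists>\<psi> \<in> hom U (grp B). \<not> has_fixed_point (\<psi> ` carrier U) B)"
  have "\<not> has_fixed_point ((fst \<circ> \<phi>) ` carrier U) A"
  proof
    assume "has_fixed_point ((fst \<circ> \<phi>) ` carrier U) A"
    then obtain x where x: "x \<in> pts A" "\<And>u. u \<in> carrier U \<Longrightarrow> act A (fst (\<phi> u)) x = x"
      by (auto simp: has_fixed_point_def)
    have "(\<lambda>u. snd (\<phi> u) x) \<in> hom U (grp B)"
      by (rule homI) (use mem x in \<open>auto simp: mult\<close>)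
    then obtain y where y: "y \<in> pts B" "\<And>u. u \<in> carrier U \<Longrightarrow> act B (snd (\<phi> u) x) y = y"
      using none by (fastforce simp: has_fixed_point_def)
    have "act (star_prod A B) (\<phi> u) (x, y) = (x, y)" if "u \<in> carrier U" for u
      using star_prod_simps(5)[of x A y B "fst (\<phi> u)" "snd (\<phi> u)"] x y that by simp
    then have "has_fixed_point (\<phi> ` carrier U) (star_prod A B)"
      using x(1) y(1) by (auto simp: has_fixed_point_def star_prod_simps)
    then show False using assms(4) by blast
  qed
  then show "fst \<circ> \<phi> \<in> hom U (grp A) \<and> \<not> has_fixed_point ((fst \<circ> \<phi>) ` carrier U) A"
    using fst_hom by blast
qed

subsection \<open>Star powers\<close>

lemma inj_relabeling:
  "inj_on Single S" "inj_on (\<lambda>y. [y]) Y" "inj_on (\<lambda>(w, f). Extend w f) Z"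
  "inj_on (\<lambda>(ys, y). ys @ [y]) V"
  by (auto simp: inj_on_def)

lemma finite_gaction_star_power:
  "finite_gaction A \<Longrightarrow> n \<ge> 1 \<Longrightarrow> finite_gaction (star_power A n)"
proof (induction A n rule: star_power.induct)
  case (2 A)
  then show ?case by (simp add: finite_gaction_relabel inj_relabeling)
next
  case (3 A n)
  then show ?case
    by (simp add: finite_gaction_relabel inj_relabeling finite_gaction_star_prod)
qed simp

lemma relabel_reflect:
  assumes "finite_gaction A" "inj_on a (carrier (grp A))" "inj_on b (pts A)"
    and "\<phi> \<in> hom U (grp (relabel a b A))"
    and "\<not> has_fixed_point (\<phi> ` carrier U) (relabel a b A)"
  obtains \<psi> where "\<psi> \<in> hom U (grp A)" "\<not> has_fixed_point (\<psi> ` carrier U) A"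
proof -
  let ?a = "inv_into (carrier (grp A)) a"
  have "?a \<in> iso (grp (relabel a b A)) (grp A)"
    using group.iso_set_sym relabel_iso[OF assms(1-3)] finite_gactionD(1)[OF assms(1)] by blast
  then have hom: "?a \<circ> \<phi> \<in> hom U (grp A)"
    using assms(4) by (auto simp: iso_def intro: hom_compose)
  have "a ` (?a \<circ> \<phi>) ` carrier U = \<phi> ` carrier U"
    using hom_in_carrier[OF assms(4)] relabel_simps(1)[OF assms(1-3)]
    by (auto simp: image_image f_inv_into_f)
  then have "\<not> has_fixed_point ((?a \<circ> \<phi>) ` carrier U) A"
    using relabel_has_fixed_point[OF assms(1-3), of "(?a \<circ> \<phi>) ` carrier U"] hom_carrier[OF hom]
      assms(5) by auto
  then show thesis using hom that by blast
qed

text \<open>The levels of the star power are peeled off one at a time, until the remaining part has a fixed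
  point or consists of a single level.\<close>

lemma star_power_reflect:
  assumes "finite_gaction A" "n \<ge> 1" "\<phi> \<in> hom U (grp (star_power A n))"
    and "\<not> has_fixed_point (\<phi> ` carrier U) (star_power A n)"
  shows "\<exists>\<psi> \<in> hom U (grp A). \<not> has_fixed_point (\<psi> ` carrier U) A"
  using assms
proof (induction A n arbitrary: \<phi> rule: star_power.induct)
  case (2 A)
  from relabel_reflect[OF 2(1) inj_relabeling(1,2), of \<phi> U] 2(3,4) show ?case by force
next
  case (3 A n)
  have fin: "finite_gaction (star_power A (Suc n))"
    using 3(2) by (simp add: finite_gaction_star_power)
  have prod: "finite_gaction (star_prod (star_power A (Suc n)) A)"
    using fin 3(2) by (rule finite_gaction_star_prod)
  obtain \<chi> where "\<chi> \<in> hom U (grp (star_prod (star_power A (Suc n)) A))"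
    "\<not> has_fixed_point (\<chi> ` carrier U) (star_prod (star_power A (Suc n)) A)"
    using relabel_reflect[OF prod inj_relabeling(3,4), of \<phi> U] 3(4,5) by auto
  from star_prod_reflect[OF fin 3(2) this] show ?case using 3(1)[OF 3(2)] by fastforce
qed simp

section \<open>Elementary implication in terms of fixed-point free subgroups\<close>

subsection \<open>Orbit representatives and equivariant maps\<close>

lemma finite_gaction_pullback:
  assumes "finite_gaction A" "group H" "finite (carrier H)" "\<phi> \<in> hom H (grp A)"
  shows "finite_gaction \<lparr>grp = H, pts = pts A, act = (\<lambda>h. act A (\<phi> h))\<rparr>"
proof -
  note A = finite_gactionD[OF assms(1)]
  interpret group_hom H "grp A" \<phi> using assms A by (simp add: group_hom_iff)
  have "group_action H (pts A) (\<lambda>h. act A (\<phi> h))"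
    by (rule group_actionI) (use assms A in auto)
  then show ?thesis using assms A by (simp add: finite_gaction_def)
qed

lemma nat_copy:
  fixes G :: "'g monoid"
  assumes "group G" "finite (carrier G)"
  obtains N :: "nat monoid" and f where "group N" "finite (carrier N)" "f \<in> iso N G"
proof -
  obtain a :: "'g \<Rightarrow> nat" where a: "inj_on a (carrier G)"
    using finite_imp_inj_to_nat_seg[OF assms(2)] by blast
  \<comment> \<open>The group is transported by relabeling the action on the empty set.\<close>
  let ?A = "\<lparr>grp = G, pts = {}, act = (\<lambda>_ _. undefined)\<rparr> :: ('g, unit) gaction"
  have A: "finite_gaction ?A"
    using assms by (auto simp: finite_gaction_def intro!: group_actionI)
  let ?N = "grp (relabel a id ?A)"
  have "finite_gaction (relabel a id ?A)"
    using A a by (intro finite_gaction_relabel) simp_all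
  then have N: "group ?N" "finite (carrier ?N)" by (simp_all add: finite_gactionD)
  have "a \<in> iso G ?N" using relabel_iso[OF A, of a id] a by simp
  then obtain f where "f \<in> iso ?N G" using group.iso_set_sym[OF assms(1)] by blast
  then show thesis using that N by blast
qed

text \<open>Representatives \<open>r x\<close> of the orbits, elements \<open>s x\<close> that carry \<open>r x\<close> to \<open>x\<close>, and the resulting
  cocycle \<open>c g x\<close>, which is the inverse of \<open>s (g x)\<close> times \<open>g\<close> times \<open>s x\<close> and takes values in
  the stabilizer of \<open>r x\<close>.\<close>

definition orbit_cocycle ::
    "('g, 'x) gaction \<Rightarrow> ('x \<Rightarrow> 'x) \<Rightarrow> ('x \<Rightarrow> 'g) \<Rightarrow> ('g \<Rightarrow> 'x \<Rightarrow> 'g) \<Rightarrow> bool"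
  where "orbit_cocycle A r s c \<longleftrightarrow>
    (\<forall>x\<in>pts A. r x \<in> pts A \<and> s x \<in> carrier (grp A) \<and> act A (s x) (r x) = x) \<and>
    (\<forall>g\<in>carrier (grp A). \<forall>x\<in>pts A. r (act A g x) = r x \<and> c g x \<in> carrier (grp A) \<and>
       act A (c g x) (r x) = r x \<and> s (act A g x) \<otimes>\<^bsub>grp A\<^esub> c g x = g \<otimes>\<^bsub>grp A\<^esub> s x) \<and>
    (\<forall>g\<in>carrier (grp A). \<forall>h\<in>carrier (grp A). \<forall>x\<in>pts A.
       c (g \<otimes>\<^bsub>grp A\<^esub> h) x = c g (act A h x) \<otimes>\<^bsub>grp A\<^esub> c h x)"

lemma orbit_cocycleD:
  assumes "orbit_cocycle A r s c"
  shows "x \<in> pts A \<Longrightarrow> r x \<in> pts A"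
    "x \<in> pts A \<Longrightarrow> s x \<in> carrier (grp A)"
    "x \<in> pts A \<Longrightarrow> act A (s x) (r x) = x"
    "g \<in> carrier (grp A) \<Longrightarrow> x \<in> pts A \<Longrightarrow> r (act A g x) = r x"
    "g \<in> carrier (grp A) \<Longrightarrow> x \<in> pts A \<Longrightarrow> c g x \<in> carrier (grp A)"
    "g \<in> carrier (grp A) \<Longrightarrow> x \<in> pts A \<Longrightarrow> act A (c g x) (r x) = r x"
    "g \<in> carrier (grp A) \<Longrightarrow> x \<in> pts A \<Longrightarrow>
      s (act A g x) \<otimes>\<^bsub>grp A\<^esub> c g x = g \<otimes>\<^bsub>grp A\<^esub> s x"
    "g \<in> carrier (grp A) \<Longrightarrow> h \<in> carrier (grp A) \<Longrightarrow> x \<in> pts A \<Longrightarrow>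
      c (g \<otimes>\<^bsub>grp A\<^esub> h) x = c g (act A h x) \<otimes>\<^bsub>grp A\<^esub> c h x"
  using assms by (simp_all add: orbit_cocycle_def)

lemma orbit_cocycle_exists:
  assumes "finite_gaction A"
  obtains r s c where "orbit_cocycle A r s c"
proof -
  note A = finite_gactionD[OF assms]
  let ?G = "grp A" and ?X = "pts A"
  interpret group ?G by (rule A(1))
  interpret group_action ?G ?X "act A" using assms by (simp add: finite_gaction_def)
  define r where "r x = (SOME y. y \<in> orbit ?G (act A) x)" for x
  have r: "r x \<in> orbit ?G (act A) x" if "x \<in> ?X" for x
    unfolding r_def by (rule someI) (rule orbit_refl[OF that])
  have rX: "r x \<in> ?X" if "x \<in> ?X" for x using r[OF that] that A(4) by (auto simp: orbit_def)
  have r_inv: "r (act A g x) = r x" if "g \<in> carrier ?G" "x \<in> ?X" for g x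
  proof -
    have gx: "act A g x \<in> ?X" using A(4) that by simp
    have "act A g x \<in> orbit ?G (act A) x" using that by (auto simp: orbit_def)
    moreover from orbit_sym[OF that(2) gx this] have "x \<in> orbit ?G (act A) (act A g x)" .
    ultimately have "y \<in> orbit ?G (act A) (act A g x) \<longleftrightarrow> y \<in> orbit ?G (act A) x" for y
    proof -
      assume *: "act A g x \<in> orbit ?G (act A) x" "x \<in> orbit ?G (act A) (act A g x)"
      have "y \<in> ?X" if "y \<in> orbit ?G (act A) (act A g x) \<or> y \<in> orbit ?G (act A) x"
        using that gx \<open>x \<in> ?X\<close> A(4) by (auto simp: orbit_def)
      then show ?thesis using * orbit_trans gx that(2) by blast
    qed
    then show ?thesis by (simp add: r_def)
  qed
  have "\<exists>g\<in>carrier ?G. act A g (r x) = x" if "x \<in> ?X" for x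
  proof -
    have "x \<in> orbit ?G (act A) (r x)" using orbit_sym[OF that rX r] that by blast
    then show ?thesis unfolding orbit_def by force
  qed
  then obtain s where s: "\<And>x. x \<in> ?X \<Longrightarrow> s x \<in> carrier ?G" "\<And>x. x \<in> ?X \<Longrightarrow> act A (s x) (r x) = x"
    by metis
  define c where "c g x = inv\<^bsub>?G\<^esub> s (act A g x) \<otimes>\<^bsub>?G\<^esub> (g \<otimes>\<^bsub>?G\<^esub> s x)" for g x
  have c: "c g x \<in> carrier ?G" "s (act A g x) \<otimes>\<^bsub>?G\<^esub> c g x = g \<otimes>\<^bsub>?G\<^esub> s x"
    if "g \<in> carrier ?G" "x \<in> ?X" for g x
    using that s A(4) by (simp_all add: c_def flip: m_assoc)
  have fixed: "act A (c g x) (r x) = r x" if gx: "g \<in> carrier ?G" "x \<in> ?X" for g x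
  proof -
    let ?t = "s (act A g x)"
    have y: "act A g x \<in> ?X" using gx A(4) by simp
    have "act A ?t (act A (c g x) (r x)) = act A (g \<otimes>\<^bsub>?G\<^esub> s x) (r x)"
      using c[OF gx] s(1)[OF y] rX[OF gx(2)] by (metis A(6))
    also have "\<dots> = act A g x" using A(6) gx s rX by simp
    also have "\<dots> = act A ?t (r x)" using s(2)[OF y] r_inv[OF gx] by simp
    finally show ?thesis
      using inj_prop[OF s(1)[OF y]] rX[OF gx(2)] c(1)[OF gx] A(4) by (meson inj_onD)
  qed
  have mult: "c (g \<otimes>\<^bsub>?G\<^esub> h) x = c g (act A h x) \<otimes>\<^bsub>?G\<^esub> c h x"
    if gh: "g \<in> carrier ?G" "h \<in> carrier ?G" and x: "x \<in> ?X" for g h x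
  proof -
    have hx: "act A h x \<in> ?X" and ghx: "act A g (act A h x) \<in> ?X" using gh x A(4) by auto
    have "s (act A g (act A h x)) \<otimes>\<^bsub>?G\<^esub> c (g \<otimes>\<^bsub>?G\<^esub> h) x = g \<otimes>\<^bsub>?G\<^esub> (h \<otimes>\<^bsub>?G\<^esub> s x)"
      using c(2)[of "g \<otimes>\<^bsub>?G\<^esub> h" x] gh x A(6) s(1) by (simp add: m_assoc)
    also have "\<dots> = (g \<otimes>\<^bsub>?G\<^esub> s (act A h x)) \<otimes>\<^bsub>?G\<^esub> c h x"
      using c[OF gh(2) x] gh s(1)[OF hx] by (simp add: m_assoc)
    also have "\<dots> = s (act A g (act A h x)) \<otimes>\<^bsub>?G\<^esub> (c g (act A h x) \<otimes>\<^bsub>?G\<^esub> c h x)"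
      using c[OF gh(1) hx] c(1)[OF gh(2) x] s(1)[OF ghx] by (simp flip: m_assoc)
    finally show ?thesis
      using c(1)[OF gh(1) hx] c(1)[OF gh(2) x] s(1)[OF ghx] c(1)[of "g \<otimes>\<^bsub>?G\<^esub> h" x] gh x by simp
  qed
  have "orbit_cocycle A r s c"
    unfolding orbit_cocycle_def using rX s r_inv c fixed mult by simp
  then show thesis by (rule that)
qed

lemma equivariant_map_exists:
  assumes "finite_gaction A" "finite_gaction B" "grp B = grp A"
    and fixed: "\<And>x. x \<in> pts A \<Longrightarrow> has_fixed_point {g \<in> carrier (grp A). act A g x = x} B"
  obtains e where "e \<in> pts A \<rightarrow> pts B"
    "\<And>g x. g \<in> carrier (grp A) \<Longrightarrow> x \<in> pts A \<Longrightarrow> e (act A g x) = act B g (e x)"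
proof -
  note A = finite_gactionD[OF assms(1)] and B = finite_gactionD[OF assms(2), unfolded assms(3)]
  obtain r s c where "orbit_cocycle A r s c" using orbit_cocycle_exists[OF assms(1)] .
  note rsc = orbit_cocycleD[OF this]
  note r = rsc(1) and s = rsc(2) and ri = rsc(4) and c = rsc(5-7)
  obtain z where z: "\<And>x. x \<in> pts A \<Longrightarrow> z x \<in> pts B"
    "\<And>x g. x \<in> pts A \<Longrightarrow> g \<in> carrier (grp A) \<Longrightarrow> act A g x = x \<Longrightarrow> act B g (z x) = z x"
    using fixed unfolding has_fixed_point_def by (simp add: Ball_def Bex_def) metis
  \<comment> \<open>The map is chosen on orbit representatives and extended by equivariance.\<close>
  define e where "e x = act B (s x) (z (r x))" for x
  have "e (act A g x) = act B g (e x)" if gx: "g \<in> carrier (grp A)" "x \<in> pts A" for g x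
  proof -
    have y: "act A g x \<in> pts A" using gx A(4) by simp
    have zB: "z (r x) \<in> pts B" using z(1) r gx by simp
    have "e (act A g x) = act B (s (act A g x)) (act B (c g x) (z (r x)))"
      using z(2)[OF r[OF gx(2)] c(1,2)[OF gx]] ri[OF gx] by (simp add: e_def)
    also have "\<dots> = act B (g \<otimes>\<^bsub>grp A\<^esub> s x) (z (r x))"
      using B(6)[OF s[OF y] c(1)[OF gx] zB] c(3)[OF gx] by simp
    also have "\<dots> = act B g (e x)" using B(6)[OF gx(1) s[OF gx(2)] zB] by (simp add: e_def)
    finally show ?thesis .
  qed
  moreover have "e \<in> pts A \<rightarrow> pts B" using B(4) s z(1) r by (auto simp: e_def)
  ultimately show thesis using that by blast
qed

subsection \<open>Covered groups\<close>

text \<open>The action \<open>A\<close> covers the group \<open>T\<close> if \<open>T\<close> has an epimorphism onto the Frattini quotient of a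
  subgroup that acts on \<open>A\<close> without fixed points. The subgroup must act without a common fixed
  point; single elements may fix points. As Frattini quotients have trivial Frattini subgroup, \<open>T\<close>
  may equivalently be replaced by its own Frattini quotient.\<close>

definition covers :: "('g, 'x) gaction \<Rightarrow> ('t, 'm) monoid_scheme \<Rightarrow> bool"
  where "covers A T \<longleftrightarrow> (\<exists>S. subgroup S (grp A) \<and> \<not> has_fixed_point S A \<and>
    epi T (frattini_quotient ((grp A)\<lparr>carrier := S\<rparr>)) \<noteq> {})"

text \<open>If \<open>A\<close> elementary implies \<open>B\<close>, each fixed-point free subgroup \<open>T\<close> of \<open>B\<close> is lifted to a minimal
  subgroup \<open>U\<close> of the auxiliary group. The equivariant map makes \<open>U\<close> fixed-point free on the star
  power, so \<open>U\<close> also maps onto a fixed-point free subgroup of \<open>A\<close>.\<close>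

lemma elem_implies_imp_covers:
  assumes "finite_gaction A" "finite_gaction B" "elem_implies A B"
    and T: "subgroup T (grp B)" "\<not> has_fixed_point T B"
  shows "covers A ((grp B)\<lparr>carrier := T\<rparr>)"
proof -
  note A = finite_gactionD[OF assms(1)] and B = finite_gactionD[OF assms(2)]
  obtain n and H0 :: "nat monoid" and \<phi> \<alpha> e \<pi> where n: "n \<ge> 1"
    and H0: "group H0" "finite (carrier H0)"
    and \<phi>: "\<phi> \<in> hom H0 (grp (star_power A n))"
    and e: "e \<in> pts (star_power A n) \<rightarrow> pts B"
      "\<forall>h\<in>carrier H0. \<forall>x\<in>pts (star_power A n). e (act (star_power A n) (\<phi> h) x) = \<alpha> h (e x)"
    and \<pi>: "\<pi> \<in> epi H0 (grp B)"
    and \<alpha>: "\<forall>h\<in>carrier H0. \<forall>z\<in>pts B. act B (\<pi> h) z = \<alpha> h z"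
    using assms(3) unfolding elem_implies_def by metis
  interpret H0: group H0 by (rule H0(1))
  interpret \<pi>: group_hom H0 "grp B" \<pi> using \<pi> H0 B by (simp add: epi_def group_hom_iff)
  have \<pi>_onto: "\<pi> ` carrier H0 = carrier (grp B)" using \<pi> by (simp add: epi_def)
  let ?K = "{h \<in> carrier H0. \<pi> h \<in> T}"
  let ?T = "(grp B)\<lparr>carrier := T\<rparr>"
  have K: "subgroup ?K H0" using subgroup_preimage[OF \<pi>.group_hom_axioms T(1)] .
  have \<pi>K: "\<pi> ` ?K = T" using \<pi>_onto subgroup.subset[OF T(1)] by (auto simp flip: \<pi>_onto)
  have hK: "group_hom (H0\<lparr>carrier := ?K\<rparr>) ?T \<pi>" using \<pi>.induced_group_hom[OF K] \<pi>K by simp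
  obtain U where U: "subgroup U (H0\<lparr>carrier := ?K\<rparr>)" "\<pi> ` U = T"
    "kernel (H0\<lparr>carrier := U\<rparr>) ?T \<pi> \<subseteq> frattini (H0\<lparr>carrier := U\<rparr>)"
    using frattini_cover[OF hK] \<pi>K H0(2) by auto
  let ?U = "H0\<lparr>carrier := U\<rparr>"
  have UH: "subgroup U H0" using H0.incl_subgroup[OF K U(1)] .
  then have Usub: "U \<subseteq> carrier H0" and gU: "group ?U"
    by (simp_all add: subgroup.subset H0.subgroup_imp_group)
  have pU: "group_hom ?U ?T \<pi>" using \<pi>.induced_group_hom[OF UH] U(2) by simp
  have \<phi>U: "\<phi> \<in> hom ?U (grp (star_power A n))"
    using \<phi> Usub by (auto simp: hom_def)
  have "\<not> has_fixed_point (\<phi> ` carrier ?U) (star_power A n)"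
  proof
    assume "has_fixed_point (\<phi> ` carrier ?U) (star_power A n)"
    then obtain x where x: "x \<in> pts (star_power A n)"
      "\<And>u. u \<in> U \<Longrightarrow> act (star_power A n) (\<phi> u) x = x" by (auto simp: has_fixed_point_def)
    have ex: "e x \<in> pts B" using e(1) x(1) by blast
    have "act B (\<pi> u) (e x) = e x" if "u \<in> U" for u
      using that Usub e(2) \<alpha> x ex by (metis subsetD)
    then have "has_fixed_point T B" using ex U(2) by (auto simp: has_fixed_point_def)
    then show False using T(2) by blast
  qed
  then obtain \<psi> where \<psi>: "\<psi> \<in> hom ?U (grp A)" "\<not> has_fixed_point (\<psi> ` U) A"
    using star_power_reflect[OF assms(1) n \<phi>U] by auto
  have h\<psi>: "group_hom ?U (grp A) \<psi>" using \<psi>(1) gU A(1) by (simp add: group_hom_iff)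
  have S: "subgroup (\<psi> ` U) (grp A)" using group_hom.img_is_subgroup[OF h\<psi>] by simp
  let ?S = "(grp A)\<lparr>carrier := \<psi> ` U\<rparr>"
  have "group_hom ?U ?S \<psi>"
    using h\<psi> group.subgroup_imp_group[OF A(1) S] by (auto simp: group_hom_iff hom_def)
  then have "epi ?T (frattini_quotient ?S) \<noteq> {}"
    using epi_frattini_quotient_of_cover[OF pU _ U(3), of ?S \<psi>] U(2) by simp
  then show ?thesis using S \<psi>(2) unfolding covers_def by blast
qed

subsection \<open>Constructing elementary implications\<close>

text \<open>If the image of \<open>R\<close> under \<open>\<pi>\<close> is covered by means of a fixed-point free subgroup \<open>S\<close>, then \<open>L\<close>
  is the fibre product of \<open>R\<close> and \<open>S\<close> over the Frattini quotient of \<open>S\<close>. By the non-generator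
  property, a subgroup of \<open>L\<close> whose first projection has the same image under \<open>\<pi>\<close> as \<open>R\<close> has all of
  \<open>S\<close> as its second projection.\<close>

lemma covers_imp_fibre_product:
  assumes "finite_gaction A" "group_hom H G \<pi>" "subgroup R H"
    and cov: "covers A (G\<lparr>carrier := \<pi> ` R\<rparr>)"
  obtains L where "subgroup L (H \<times>\<times> grp A)" "fst ` L = R"
    "\<And>V. subgroup V (H \<times>\<times> grp A) \<Longrightarrow> V \<subseteq> L \<Longrightarrow> \<pi> ` fst ` V = \<pi> ` R \<Longrightarrow>
      \<not> has_fixed_point (snd ` V) A"
proof -
  note A = finite_gactionD[OF assms(1)]
  interpret \<pi>: group_hom H G \<pi> by fact
  interpret A: group "grp A" by (rule A(1))
  let ?T = "G\<lparr>carrier := \<pi> ` R\<rparr>"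
  obtain S q where S: "subgroup S (grp A)" "\<not> has_fixed_point S A"
    and q: "q \<in> epi ?T (frattini_quotient ((grp A)\<lparr>carrier := S\<rparr>))"
    using cov unfolding covers_def by blast
  let ?S = "(grp A)\<lparr>carrier := S\<rparr>"
  let ?k = "\<lambda>a. frattini ?S #>\<^bsub>?S\<^esub> a"
  have gS: "group ?S" using S(1) by (rule A.subgroup_imp_group)
  have Ssub: "S \<subseteq> carrier (grp A)" and Rsub: "R \<subseteq> carrier H"
    using S(1) assms(3) by (simp_all add: subgroup.subset)
  have gT: "group ?T"
    using \<pi>.subgroup_img_is_subgroup[OF assms(3)] \<pi>.H.subgroup_imp_group by blast
  have k: "group_hom ?S (frattini_quotient ?S) ?k" "?k ` S = carrier (frattini_quotient ?S)"
    using frattini_coset_epi[OF gS] gS group_frattini_quotient[OF gS]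
    by (auto simp: epi_def group_hom_iff)
  interpret k: group_hom ?S "frattini_quotient ?S" ?k by (rule k(1))
  have "group_hom ?T (frattini_quotient ?S) q"
    using q gT group_frattini_quotient[OF gS] by (simp add: epi_def group_hom_iff)
  moreover have "group_hom (H\<lparr>carrier := R\<rparr>) ?T \<pi>"
    by (rule \<pi>.induced_group_hom[OF assms(3)])
  ultimately have "q \<circ> \<pi> \<in> hom (H\<lparr>carrier := R\<rparr>) (frattini_quotient ?S)"
    by (auto simp: group_hom_iff intro: hom_compose)
  then interpret q: group_hom "H\<lparr>carrier := R\<rparr>" "frattini_quotient ?S" "q \<circ> \<pi>"
    using \<pi>.G.subgroup_imp_group[OF assms(3)] group_frattini_quotient[OF gS]
    by (simp add: group_hom_iff)
  define L where "L = {(h, a). h \<in> R \<and> a \<in> S \<and> ?k a = q (\<pi> h)}"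
  have "subgroup L (H \<times>\<times> grp A)"
  proof (rule group.subgroupI[OF DirProd_group[OF \<pi>.G.group_axioms A.group_axioms]])
    show "L \<subseteq> carrier (H \<times>\<times> grp A)" using Ssub Rsub by (auto simp: L_def)
    have "(\<one>\<^bsub>H\<^esub>, \<one>\<^bsub>grp A\<^esub>) \<in> L"
      using subgroup.one_closed[OF assms(3)] subgroup.one_closed[OF S(1)] k.hom_one q.hom_one
      by (simp add: L_def)
    then show "L \<noteq> {}" by blast
  next
    fix u assume u: "u \<in> L"
    obtain h a where ha: "u = (h, a)" "h \<in> R" "a \<in> S" "?k a = q (\<pi> h)"
      using u by (auto simp: L_def)
    have "?k (inv\<^bsub>grp A\<^esub> a) = q (\<pi> (inv\<^bsub>H\<^esub> h))"
      using k.hom_inv[of a] q.hom_inv[of h] ha S(1) assms(3) by simp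
    then have "(inv\<^bsub>H\<^esub> h, inv\<^bsub>grp A\<^esub> a) \<in> L"
      using ha subgroup.m_inv_closed[OF assms(3)] subgroup.m_inv_closed[OF S(1)]
      by (simp add: L_def)
    then show "inv\<^bsub>H \<times>\<times> grp A\<^esub> u \<in> L"
      using ha Ssub Rsub by (auto simp: inv_DirProd \<pi>.G.group_axioms A.group_axioms subset_iff)
  next
    fix u v assume u: "u \<in> L" and v: "v \<in> L"
    obtain h a where ha: "u = (h, a)" "h \<in> R" "a \<in> S" "?k a = q (\<pi> h)"
      using u by (auto simp: L_def)
    obtain h' a' where ha': "v = (h', a')" "h' \<in> R" "a' \<in> S" "?k a' = q (\<pi> h')"
      using v by (auto simp: L_def)
    have "?k (a \<otimes>\<^bsub>grp A\<^esub> a') = q (\<pi> (h \<otimes>\<^bsub>H\<^esub> h'))"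
      using k.hom_mult[of a a'] q.hom_mult[of h h'] ha ha' by simp
    then show "u \<otimes>\<^bsub>H \<times>\<times> grp A\<^esub> v \<in> L"
      using ha ha' subgroup.m_closed[OF assms(3)] subgroup.m_closed[OF S(1)]
      by (simp add: L_def)
  qed
  moreover have "fst ` L = R"
  proof
    show "R \<subseteq> fst ` L"
    proof
      fix h assume h: "h \<in> R"
      then have "q (\<pi> h) \<in> ?k ` S" using q.hom_closed[of h] k(2) by simp
      then obtain a where "a \<in> S" "q (\<pi> h) = ?k a" by blast
      then have "(h, a) \<in> L" using h by (simp add: L_def)
      then show "h \<in> fst ` L" by force
    qed
  qed (auto simp: L_def)
  moreover have "\<not> has_fixed_point (snd ` V) A"
    if V: "subgroup V (H \<times>\<times> grp A)" "V \<subseteq> L" "\<pi> ` fst ` V = \<pi> ` R" for V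
  proof -
    have "group_hom (H \<times>\<times> grp A) (grp A) snd"
      using \<pi>.G.group_axioms A.group_axioms
      by (auto simp: group_hom_iff hom_def intro: DirProd_group)
    then have "subgroup (snd ` V) (grp A)"
      using group_hom.subgroup_img_is_subgroup V(1) by blast
    moreover have VS: "snd ` V \<subseteq> S" using V(2) by (auto simp: L_def)
    ultimately have sub: "subgroup (snd ` V) ?S" using A.subgroup_incl S(1) by blast
    have "\<exists>u\<in>snd ` V. ?k u = ?k a" if a: "a \<in> S" for a
    proof -
      have "?k a \<in> q ` \<pi> ` fst ` V" using q k(2) a V(3) by (auto simp: epi_def)
      then obtain v where v: "v \<in> V" "?k a = q (\<pi> (fst v))" by blast
      then have "?k (snd v) = ?k a" using V(2) by (auto simp: L_def)
      then show ?thesis using v(1) by blast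
    qed
    moreover have "finite S" using Ssub A(2) by (rule finite_subset)
    ultimately have "snd ` V = S" using frattini_nongenerator[OF gS _ sub] by simp
    then show ?thesis using S(2) by simp
  qed
  ultimately show thesis by (rule that)
qed

text \<open>The inductive step: from an action of \<open>H\<close> on \<open>W\<close> and an epimorphism \<open>\<pi>\<close> onto the group of \<open>B\<close>
  to a group \<open>K\<close> mapping onto \<open>H\<close> and acting on the star product of \<open>W\<close> and \<open>A\<close>. Whenever the
  stabilizer of \<open>x\<close> has a fixed-point free image in the group of \<open>B\<close>, the stabilizers of the points
  \<open>(x, y)\<close> have strictly smaller images. The group \<open>K\<close> consists of the pairs \<open>(h, f)\<close> for which every \<open>f x\<close> is matched with the
  cocycle value \<open>c h x\<close> in a fibre product \<open>L (r x)\<close>. The cocycle is needed because the stabilizer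
  of \<open>r x\<close> maps to a subgroup of \<open>A\<close> only after passing to such a fibre product, and this map has
  to be induced to all of \<open>H\<close>.\<close>

lemma refine_stabilizers:
  fixes W :: "('w, 'p) gaction" and A :: "('g, 'x) gaction" and B :: "('k, 'z) gaction"
    and H :: "'h monoid"
  assumes W: "finite_gaction W" and A: "finite_gaction A" and B: "finite_gaction B"
    and H: "group H" "finite (carrier H)"
    and \<phi>: "\<phi> \<in> hom H (grp W)" and \<pi>: "\<pi> \<in> epi H (grp B)"
    and cov: "\<And>T. subgroup T (grp B) \<Longrightarrow> \<not> has_fixed_point T B \<Longrightarrow>
      covers A ((grp B)\<lparr>carrier := T\<rparr>)"
  obtains K :: "('h \<times> ('p \<Rightarrow> 'g)) monoid" and \<phi>' \<pi>' where
    "group K" "finite (carrier K)" "\<phi>' \<in> hom K (grp (star_prod W A))" "\<pi>' \<in> epi K (grp B)"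
    "\<And>x y. x \<in> pts W \<Longrightarrow> y \<in> pts A \<Longrightarrow>
      \<pi>' ` {k \<in> carrier K. act (star_prod W A) (\<phi>' k) (x, y) = (x, y)} \<subseteq>
      \<pi> ` {h \<in> carrier H. act W (\<phi> h) x = x}"
    "\<And>x y. x \<in> pts W \<Longrightarrow> y \<in> pts A \<Longrightarrow>
      \<not> has_fixed_point (\<pi> ` {h \<in> carrier H. act W (\<phi> h) x = x}) B \<Longrightarrow>
      \<pi>' ` {k \<in> carrier K. act (star_prod W A) (\<phi>' k) (x, y) = (x, y)} \<noteq>
      \<pi> ` {h \<in> carrier H. act W (\<phi> h) x = x}"
proof -
  note W' = finite_gactionD[OF W] and A' = finite_gactionD[OF A] and B' = finite_gactionD[OF B]
  interpret H: group H by (rule H(1))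
  interpret A: group "grp A" by (rule A'(1))
  interpret \<pi>: group_hom H "grp B" \<pi> using \<pi> H B' by (simp add: epi_def group_hom_iff)
  interpret \<phi>: group_hom H "grp W" \<phi> using \<phi> H W' by (simp add: group_hom_iff)
  let ?X = "pts W"
  define D where "D = \<lparr>grp = H, pts = pts W, act = (\<lambda>h. act W (\<phi> h))\<rparr>"
  have D: "finite_gaction D" unfolding D_def by (rule finite_gaction_pullback[OF W H \<phi>])
  have D_simps [simp]: "grp D = H" "pts D = ?X" "act D h = act W (\<phi> h)" for h
    by (simp_all add: D_def)
  define stab where "stab x = {h \<in> carrier H. act W (\<phi> h) x = x}" for x
  have stab: "subgroup (stab x) H" if "x \<in> ?X" for x
    using group_action.stabilizer_subgroup[of H ?X "act D" x] D that
    by (simp add: finite_gaction_def stabilizer_def stab_def)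
  obtain r s c where "orbit_cocycle D r s c" using orbit_cocycle_exists[OF D] .
  note rsc = orbit_cocycleD[OF this, simplified]
  have c_stab: "c h x \<in> stab (r x)" if "h \<in> carrier H" "x \<in> ?X" for h x
    using rsc that by (simp add: stab_def)
  have "\<exists>L. subgroup L (H \<times>\<times> grp A) \<and> fst ` L = stab x \<and>
      (\<forall>V. subgroup V (H \<times>\<times> grp A) \<longrightarrow> V \<subseteq> L \<longrightarrow> \<pi> ` fst ` V = \<pi> ` stab x \<longrightarrow>
        has_fixed_point (\<pi> ` stab x) B \<or> \<not> has_fixed_point (snd ` V) A)" if x: "x \<in> ?X" for x
  proof (cases "has_fixed_point (\<pi> ` stab x) B")
    case True
    \<comment> \<open>Nothing has to shrink here, and the trivial subgroup of \<open>A\<close> will do.\<close>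
    have "subgroup (stab x \<times> {\<one>\<^bsub>grp A\<^esub>}) (H \<times>\<times> grp A)"
      by (rule DirProd_subgroups[OF H(1) stab[OF x] A'(1) A.triv_subgroup])
    then show ?thesis using True by (intro exI[of _ "stab x \<times> {\<one>\<^bsub>grp A\<^esub>}"]) simp
  next
    case False
    have "covers A ((grp B)\<lparr>carrier := \<pi> ` stab x\<rparr>)"
      using cov \<pi>.subgroup_img_is_subgroup[OF stab[OF x]] False by blast
    from covers_imp_fibre_product[OF A \<pi>.group_hom_axioms stab[OF x] this] show ?thesis by metis
  qed
  then obtain L where L: "\<And>x. x \<in> ?X \<Longrightarrow> subgroup (L x) (H \<times>\<times> grp A)"
    and fst_L: "\<And>x. x \<in> ?X \<Longrightarrow> fst ` L x = stab x"
    and L_proper: "\<And>x V. x \<in> ?X \<Longrightarrow> subgroup V (H \<times>\<times> grp A) \<Longrightarrow> V \<subseteq> L x \<Longrightarrow>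
      \<pi> ` fst ` V = \<pi> ` stab x \<Longrightarrow> has_fixed_point (\<pi> ` stab x) B \<or> \<not> has_fixed_point (snd ` V) A"
    by metis
  have L_sub: "L x \<subseteq> carrier H \<times> carrier (grp A)" if "x \<in> ?X" for x
    using subgroup.subset[OF L[OF that]] by simp
  have L_mult: "(h \<otimes>\<^bsub>H\<^esub> h', a \<otimes>\<^bsub>grp A\<^esub> a') \<in> L x"
    if "x \<in> ?X" "(h, a) \<in> L x" "(h', a') \<in> L x" for x h h' a a'
    using subgroup.m_closed[OF L[OF that(1)] that(2,3)] by simp
  let ?P = "star_prod D A"
  have P: "finite_gaction ?P" by (rule finite_gaction_star_prod[OF D A])
  define K where "K = {(h, f) \<in> carrier (grp ?P). \<forall>x\<in>?X. (c h x, f x) \<in> L (r x)}"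
  have K_iff: "(h, f) \<in> K \<longleftrightarrow> h \<in> carrier H \<and> f \<in> ?X \<rightarrow>\<^sub>E carrier (grp A) \<and>
      (\<forall>x\<in>?X. (c h x, f x) \<in> L (r x))" for h f
    by (auto simp: K_def star_prod_simps)
  have K_ex: "\<exists>f. (h, f) \<in> K" if h: "h \<in> carrier H" for h
  proof -
    have "\<exists>a. (c h x, a) \<in> L (r x)" if "x \<in> ?X" for x
      using c_stab[OF h that] fst_L[OF rsc(1)[OF that]] by force
    then obtain f where f: "\<And>x. x \<in> ?X \<Longrightarrow> (c h x, f x) \<in> L (r x)" by metis
    have "f x \<in> carrier (grp A)" if "x \<in> ?X" for x using f[OF that] L_sub[OF rsc(1)[OF that]] by auto
    then have "(h, restrict f ?X) \<in> K" using f h by (auto simp: K_iff)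
    then show ?thesis by blast
  qed
  have K_mult: "(h \<otimes>\<^bsub>H\<^esub> h', \<lambda>x\<in>?X. f (act W (\<phi> h') x) \<otimes>\<^bsub>grp A\<^esub> f' x) \<in> K"
    if k: "(h, f) \<in> K" "(h', f') \<in> K" for h f h' f'
  proof -
    have h: "h \<in> carrier H" "h' \<in> carrier H"
      and f: "f \<in> ?X \<rightarrow>\<^sub>E carrier (grp A)" "f' \<in> ?X \<rightarrow>\<^sub>E carrier (grp A)"
      using k by (auto simp: K_iff)
    have hx: "act W (\<phi> h') x \<in> ?X" if "x \<in> ?X" for x using W'(4) h that by simp
    have "(c (h \<otimes>\<^bsub>H\<^esub> h') x, f (act W (\<phi> h') x) \<otimes>\<^bsub>grp A\<^esub> f' x) \<in> L (r x)" if x: "x \<in> ?X" for x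
    proof -
      have "(c h (act W (\<phi> h') x), f (act W (\<phi> h') x)) \<in> L (r x)"
        using k(1) hx[OF x] rsc(4)[OF h(2) x] by (auto simp: K_iff)
      moreover have "(c h' x, f' x) \<in> L (r x)" using k(2) x by (simp add: K_iff)
      ultimately show ?thesis
        using L_mult[OF rsc(1)[OF x]] rsc(8)[OF h x] by simp
    qed
    moreover have "f (act W (\<phi> h') x) \<otimes>\<^bsub>grp A\<^esub> f' x \<in> carrier (grp A)" if "x \<in> ?X" for x
      using f hx[OF that] that by (intro A.m_closed) auto
    ultimately show ?thesis using h by (simp add: K_iff)
  qed
  have subK: "subgroup K (grp ?P)"
  proof (rule finite_closed_imp_subgroup)
    show "group (grp ?P)" "finite (carrier (grp ?P))" using finite_gactionD[OF P] by auto
    show "K \<subseteq> carrier (grp ?P)" by (auto simp: K_def)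
    show "K \<noteq> {}" using K_ex[of "\<one>\<^bsub>H\<^esub>"] by auto
    fix u v assume "u \<in> K" "v \<in> K"
    then show "u \<otimes>\<^bsub>grp ?P\<^esub> v \<in> K"
      using K_mult by (cases u; cases v) (simp add: star_prod_simps)
  qed
  let ?K = "(grp ?P)\<lparr>carrier := K\<rparr>"
  let ?\<phi> = "\<lambda>(h, f). (\<phi> h, f)" and ?\<pi> = "\<lambda>(h, f). \<pi> h"
  let ?stab' = "\<lambda>x y. {k \<in> carrier ?K. act (star_prod W A) (?\<phi> k) (x, y) = (x, y)}"
  have stab'_iff: "(h, f) \<in> ?stab' x y \<longleftrightarrow> (h, f) \<in> K \<and> h \<in> stab x \<and> act A (f x) y = y"
    if "x \<in> ?X" "y \<in> pts A" for x y h f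
    using that by (auto simp: star_prod_simps stab_def K_iff)
  show thesis
  proof (rule that[of ?K ?\<phi> ?\<pi>])
    show "group ?K"
      using group.subgroup_imp_group[OF finite_gactionD(1)[OF P] subK] .
    show "finite (carrier ?K)"
      using finite_subset[OF subgroup.subset[OF subK] finite_gactionD(2)[OF P]] by simp
    show "?\<phi> \<in> hom ?K (grp (star_prod W A))"
    proof (rule homI)
      fix u v assume "u \<in> carrier ?K" "v \<in> carrier ?K"
      then show "?\<phi> (u \<otimes>\<^bsub>?K\<^esub> v) = ?\<phi> u \<otimes>\<^bsub>grp (star_prod W A)\<^esub> ?\<phi> v"
        by (cases u; cases v) (simp add: star_prod_simps K_iff)
    next
      fix u assume "u \<in> carrier ?K"
      then show "?\<phi> u \<in> carrier (grp (star_prod W A))"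
        by (cases u) (simp add: star_prod_simps K_iff)
    qed
    show "?\<pi> \<in> epi ?K (grp B)"
      unfolding epi_iff_subset
    proof
      show "?\<pi> \<in> hom ?K (grp B)"
      proof (rule homI)
        fix u v assume "u \<in> carrier ?K" "v \<in> carrier ?K"
        then show "?\<pi> (u \<otimes>\<^bsub>?K\<^esub> v) = ?\<pi> u \<otimes>\<^bsub>grp B\<^esub> ?\<pi> v"
          by (cases u; cases v) (simp add: star_prod_simps K_iff)
      next
        fix u assume "u \<in> carrier ?K"
        then show "?\<pi> u \<in> carrier (grp B)" by (cases u) (simp add: K_iff)
      qed
      show "carrier (grp B) \<subseteq> ?\<pi> ` carrier ?K"
      proof
        fix g assume "g \<in> carrier (grp B)"
        then obtain h where h: "h \<in> carrier H" "g = \<pi> h" using \<pi> by (auto simp: epi_def)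
        then obtain f where "(h, f) \<in> K" using K_ex by blast
        then show "g \<in> ?\<pi> ` carrier ?K" using h(2) by force
      qed
    qed
    fix x y assume x: "x \<in> ?X" and y: "y \<in> pts A"
    show "?\<pi> ` ?stab' x y \<subseteq> \<pi> ` {h \<in> carrier H. act W (\<phi> h) x = x}"
    proof
      fix g assume "g \<in> ?\<pi> ` ?stab' x y"
      then obtain h f where "(h, f) \<in> ?stab' x y" "g = \<pi> h" by auto
      then have "h \<in> stab x" using stab'_iff[OF x y] by blast
      then show "g \<in> \<pi> ` {h \<in> carrier H. act W (\<phi> h) x = x}"
        using \<open>g = \<pi> h\<close> by (simp add: stab_def)
    qed
    assume "\<not> has_fixed_point (\<pi> ` {h \<in> carrier H. act W (\<phi> h) x = x}) B"
    then have nofix: "\<not> has_fixed_point (\<pi> ` stab x) B" by (simp add: stab_def)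
    show "?\<pi> ` ?stab' x y \<noteq> \<pi> ` {h \<in> carrier H. act W (\<phi> h) x = x}"
    proof
      assume "?\<pi> ` ?stab' x y = \<pi> ` {h \<in> carrier H. act W (\<phi> h) x = x}"
      then have full: "?\<pi> ` ?stab' x y = \<pi> ` stab x" by (simp add: stab_def)
      note rx = rsc(1)[OF x] and sx = rsc(2)[OF x]
      \<comment> \<open>By the assumed equality, transported along \<open>s x\<close>, the first projection of \<open>V\<close> has the same
        image under \<open>\<pi>\<close> as the stabilizer of \<open>r x\<close>, whereas the second projection fixes \<open>y\<close>.\<close>
      define V where "V = {(c h x, f x) |h f. (h, f) \<in> ?stab' x y}"
      have V_memI: "(c h x, f x) \<in> V" if "(h, f) \<in> ?stab' x y" for h f
        using that by (auto simp: V_def)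
      have "V \<subseteq> L (r x)"
        using stab'_iff[OF x y] x by (auto simp: V_def K_iff simp del: split_paired_All)
      have V: "subgroup V (H \<times>\<times> grp A)"
      proof (rule finite_closed_imp_subgroup)
        show "group (H \<times>\<times> grp A)" by (rule DirProd_group[OF H(1) A'(1)])
        show "finite (carrier (H \<times>\<times> grp A))" using H(2) A'(2) by simp
        show "V \<subseteq> carrier (H \<times>\<times> grp A)" using \<open>V \<subseteq> L (r x)\<close> L_sub[OF rx] by auto
        have "\<pi> \<one>\<^bsub>H\<^esub> \<in> ?\<pi> ` ?stab' x y"
          unfolding full using subgroup.one_closed[OF stab[OF x]] by blast
        then show "V \<noteq> {}" using V_memI by auto
        fix u v assume "u \<in> V" "v \<in> V"
        then obtain h f h' f' where u: "u = (c h x, f x)" "(h, f) \<in> ?stab' x y"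
          and v: "v = (c h' x, f' x)" "(h', f') \<in> ?stab' x y" unfolding V_def by blast
        have k: "(h, f) \<in> K" "(h', f') \<in> K" "h \<in> stab x" "h' \<in> stab x"
          "act A (f x) y = y" "act A (f' x) y = y"
          using u(2) v(2) stab'_iff[OF x y] by blast+
        then have hh: "h \<in> carrier H" "h' \<in> carrier H" "act W (\<phi> h') x = x"
          and f: "f x \<in> carrier (grp A)" "f' x \<in> carrier (grp A)"
          using x by (auto simp: K_iff stab_def)
        let ?f = "\<lambda>x\<in>?X. f (act W (\<phi> h') x) \<otimes>\<^bsub>grp A\<^esub> f' x"
        have "(h \<otimes>\<^bsub>H\<^esub> h', ?f) \<in> ?stab' x y"
          unfolding stab'_iff[OF x y]
          using K_mult[OF k(1,2)] subgroup.m_closed[OF stab[OF x] k(3,4)] k(5,6) x hh f y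
          by (simp add: A'(6))
        from V_memI[OF this] show "u \<otimes>\<^bsub>H \<times>\<times> grp A\<^esub> v \<in> V"
          using u(1) v(1) rsc(8)[OF hh(1,2) x] hh(3) x by simp
      qed
      have sc: "\<pi> (s x) \<otimes>\<^bsub>grp B\<^esub> \<pi> (c h x) = \<pi> h \<otimes>\<^bsub>grp B\<^esub> \<pi> (s x)" if "h \<in> stab x" for h
      proof -
        have h: "h \<in> carrier H" "act W (\<phi> h) x = x" using that by (auto simp: stab_def)
        have "s x \<otimes>\<^bsub>H\<^esub> c h x = h \<otimes>\<^bsub>H\<^esub> s x" using rsc(7)[OF h(1) x] h(2) by simp
        then have "\<pi> (s x \<otimes>\<^bsub>H\<^esub> c h x) = \<pi> (h \<otimes>\<^bsub>H\<^esub> s x)" by simp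
        then show ?thesis using sx h(1) rsc(5)[OF h(1) x] by simp
      qed
      have "\<pi> ` fst ` V = \<pi> ` stab (r x)"
      proof
        show "\<pi> ` fst ` V \<subseteq> \<pi> ` stab (r x)"
          using \<open>V \<subseteq> L (r x)\<close> fst_L[OF rx] by (metis image_mono)
        show "\<pi> ` stab (r x) \<subseteq> \<pi> ` fst ` V"
        proof
          fix t assume "t \<in> \<pi> ` stab (r x)"
          then obtain g where g: "g \<in> carrier H" "act W (\<phi> g) (r x) = r x" "t = \<pi> g"
            by (auto simp: stab_def)
          let ?h = "s x \<otimes>\<^bsub>H\<^esub> g \<otimes>\<^bsub>H\<^esub> inv\<^bsub>H\<^esub> s x"
          have "act W (\<phi> (inv\<^bsub>H\<^esub> s x)) x = r x"
          proof -
            have "act W (\<phi> (inv\<^bsub>H\<^esub> s x)) (act W (\<phi> (s x)) (r x)) = r x"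
              using finite_gactionD(6)[OF D, of "inv\<^bsub>H\<^esub> s x" "s x" "r x"]
                finite_gactionD(5)[OF D, of "r x"] sx rx by (simp del: \<phi>.hom_inv \<phi>.hom_mult)
            then show ?thesis using rsc(3)[OF x] by simp
          qed
          then have "?h \<in> stab x"
            using finite_gactionD(6)[OF D] sx g rx x rsc(3)[OF x]
            by (simp add: stab_def del: \<phi>.hom_inv \<phi>.hom_mult)
          then have "\<pi> ?h \<in> ?\<pi> ` ?stab' x y" unfolding full by blast
          then obtain h f where hf: "(h, f) \<in> ?stab' x y" "\<pi> ?h = \<pi> h" by auto
          then have hs: "h \<in> stab x" using stab'_iff[OF x y] by blast
          then have hc: "h \<in> carrier H" by (simp add: stab_def)
          have cc: "\<pi> (c h x) \<in> carrier (grp B)" using rsc(5)[OF hc x] by simp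
          have "\<pi> (s x) \<otimes>\<^bsub>grp B\<^esub> \<pi> (c h x) = \<pi> (s x) \<otimes>\<^bsub>grp B\<^esub> \<pi> g"
            using sc[OF hs] hf(2)[symmetric] sx g(1) by (simp add: \<pi>.H.m_assoc)
          then have "\<pi> (c h x) = t" using g sx cc by simp
          then show "t \<in> \<pi> ` fst ` V" using V_memI[OF hf(1)] by force
        qed
      qed
      from L_proper[OF rx V \<open>V \<subseteq> L (r x)\<close> this]
      have "has_fixed_point (\<pi> ` stab (r x)) B \<or> \<not> has_fixed_point (snd ` V) A" .
      moreover have "has_fixed_point (snd ` V) A"
        using y stab'_iff[OF x y] by (auto simp: has_fixed_point_def V_def intro!: bexI[of _ y])
      moreover have False if fp: "has_fixed_point (\<pi> ` stab (r x)) B"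
      proof -
        obtain z where z: "z \<in> pts B" "\<And>g. g \<in> stab (r x) \<Longrightarrow> act B (\<pi> g) z = z"
          using fp by (auto simp: has_fixed_point_def)
        have "act B (\<pi> h) (act B (\<pi> (s x)) z) = act B (\<pi> (s x)) z" if h: "h \<in> stab x" for h
        proof -
          have hc: "h \<in> carrier H" using h by (simp add: stab_def)
          have "act B (\<pi> h) (act B (\<pi> (s x)) z) = act B (\<pi> (s x) \<otimes>\<^bsub>grp B\<^esub> \<pi> (c h x)) z"
            using B'(6)[of "\<pi> h" "\<pi> (s x)" z] sc[OF h] hc sx z(1) by simp
          also have "\<dots> = act B (\<pi> (s x)) z"
            using B'(6)[of "\<pi> (s x)" "\<pi> (c h x)" z] z(2)[OF c_stab[OF hc x]] sx z(1)
              rsc(5)[OF hc x] by simp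
          finally show ?thesis .
        qed
        moreover have "act B (\<pi> (s x)) z \<in> pts B" using B'(4) sx z(1) by simp
        ultimately have "has_fixed_point (\<pi> ` stab x) B" by (auto simp: has_fixed_point_def)
        then show False using nofix by blast
      qed
      ultimately show False by blast
    qed
  qed
qed

text \<open>Each refinement makes the fixed-point free images of stabilizers smaller. After more steps than
  the group of \<open>B\<close> has elements, the image of every stabilizer has a fixed point, and an equivariant
  map exists.\<close>

lemma covers_imp_elem_implies:
  assumes A: "finite_gaction A" and B: "finite_gaction B"
    and cov: "\<And>T. subgroup T (grp B) \<Longrightarrow> \<not> has_fixed_point T B \<Longrightarrow>
      covers A ((grp B)\<lparr>carrier := T\<rparr>)"
  shows "elem_implies A B"
proof -
  note A' = finite_gactionD[OF A] and B' = finite_gactionD[OF B]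
  let ?G = "grp B"
  define stab where "stab W (H :: nat monoid) \<phi> x = {h \<in> carrier H. act W (\<phi> h) x = x}"
    for W :: "(('a, 'b) star_elem, 'b list) gaction" and H \<phi> x
  let ?good = "\<lambda>k n H \<phi> \<pi>. n \<ge> 1 \<and> group H \<and> finite (carrier H) \<and>
    \<phi> \<in> hom H (grp (star_power A n)) \<and> \<pi> \<in> epi H ?G \<and>
    (\<forall>x \<in> pts (star_power A n). has_fixed_point (\<pi> ` stab (star_power A n) H \<phi> x) B \<or>
      card (\<pi> ` stab (star_power A n) H \<phi> x) + k \<le> card (carrier ?G))"
  \<comment> \<open>\<open>?good k\<close> says that fixed-point free images of stabilizers miss at least \<open>k\<close> elements of the
    group of \<open>B\<close>. The induction starts with the trivial action on the first star power.\<close>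
  have step: "\<exists>n H \<phi> \<pi>. ?good k n H \<phi> \<pi>" for k
  proof (induction k)
    case 0
    obtain H :: "nat monoid" and \<pi> where H: "group H" "finite (carrier H)" "\<pi> \<in> iso H ?G"
      using nat_copy[OF B'(1,2)] .
    have \<pi>: "\<pi> \<in> epi H ?G" using H(3) by (simp add: iso_iff_mon_epi)
    let ?W = "star_power A (Suc 0)"
    have W: "finite_gaction ?W" by (rule finite_gaction_star_power[OF A]) simp
    let ?\<phi> = "\<lambda>_. \<one>\<^bsub>grp ?W\<^esub>"
    have "?\<phi> \<in> hom H (grp ?W)"
      using finite_gactionD(1)[OF W] by (auto simp: hom_def group.is_monoid monoid.l_one)
    moreover have "card (\<pi> ` stab ?W H ?\<phi> x) + 0 \<le> card (carrier ?G)" for x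
      using \<pi> B'(2) by (auto simp: epi_def stab_def intro!: card_mono)
    ultimately show ?case using H(1,2) \<pi> 
      by (intro exI[of _ "Suc 0"] exI[of _ H] exI[of _ ?\<phi>] exI[of _ \<pi>]) simp
  next
    case (Suc k)
    then obtain n and H :: "nat monoid" and \<phi> \<pi> where n: "n \<ge> 1" and H: "group H" "finite (carrier H)"
      and \<phi>: "\<phi> \<in> hom H (grp (star_power A n))" and \<pi>: "\<pi> \<in> epi H ?G"
      and small: "\<And>x. x \<in> pts (star_power A n) \<Longrightarrow>
        has_fixed_point (\<pi> ` stab (star_power A n) H \<phi> x) B \<or>
        card (\<pi> ` stab (star_power A n) H \<phi> x) + k \<le> card (carrier ?G)" by blast
    let ?W = "star_power A n" and ?P = "star_prod (star_power A n) A"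
    have W: "finite_gaction ?W" by (rule finite_gaction_star_power[OF A n])
    have P: "finite_gaction ?P" by (rule finite_gaction_star_prod[OF W A])
    from refine_stabilizers[OF W A B H \<phi> \<pi> cov, folded stab_def]
    obtain K :: "(nat \<times> ('b list \<Rightarrow> 'a)) monoid" and \<phi>' \<pi>' where
      K: "group K" "finite (carrier K)" and \<phi>': "\<phi>' \<in> hom K (grp ?P)" and \<pi>': "\<pi>' \<in> epi K ?G"
      and sub: "\<And>x y. x \<in> pts ?W \<Longrightarrow> y \<in> pts A \<Longrightarrow>
        \<pi>' ` {k \<in> carrier K. act ?P (\<phi>' k) (x, y) = (x, y)} \<subseteq> \<pi> ` stab ?W H \<phi> x"
      and ne: "\<And>x y. x \<in> pts ?W \<Longrightarrow> y \<in> pts A \<Longrightarrow> \<not> has_fixed_point (\<pi> ` stab ?W H \<phi> x) B \<Longrightarrow>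
        \<pi>' ` {k \<in> carrier K. act ?P (\<phi>' k) (x, y) = (x, y)} \<noteq> \<pi> ` stab ?W H \<phi> x" by blast
    obtain N :: "nat monoid" and \<iota> where N: "group N" "finite (carrier N)" "\<iota> \<in> iso N K"
      using nat_copy[OF K] .
    have \<iota>: "\<iota> \<in> hom N K" "\<iota> ` carrier N = carrier K" "\<iota> \<in> epi N K"
      using N(3) by (auto simp: iso_iff_mon_epi epi_def)
    let ?a = "\<lambda>(w, f). Extend w f" and ?b = "\<lambda>(ys, y). ys @ [y]"
    let ?V = "star_power A (Suc n)"
    have V: "?V = relabel ?a ?b ?P" using n by (cases n) simp_all
    note V_simps = relabel_simps[OF P inj_relabeling(3,4), folded V]
    let ?\<phi> = "?a \<circ> (\<phi>' \<circ> \<iota>)" and ?\<pi> = "\<pi>' \<circ> \<iota>"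
    have "?a \<in> hom (grp ?P) (grp ?V)"
      using relabel_iso[OF P inj_relabeling(3,4)] by (simp add: V iso_def)
    then have \<phi>N: "?\<phi> \<in> hom N (grp ?V)"
      using \<phi>' \<iota>(1) by (intro hom_compose) auto
    have \<pi>N: "?\<pi> \<in> epi N ?G" using \<pi>' \<iota>(3) by (rule epi_compose[rotated])
    have "has_fixed_point (?\<pi> ` stab ?V N ?\<phi> z) B \<or>
      card (?\<pi> ` stab ?V N ?\<phi> z) + Suc k \<le> card (carrier ?G)" if z: "z \<in> pts ?V" for z
    proof -
      obtain x y where x: "x \<in> pts ?W" and y: "y \<in> pts A" and zxy: "z = ?b (x, y)"
        using z by (auto simp: V_simps star_prod_simps)
      let ?S = "{k \<in> carrier K. act ?P (\<phi>' k) (x, y) = (x, y)}"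
      have xy: "(x, y) \<in> pts ?P" using x y by (simp add: star_prod_simps)
      have "act ?V (?\<phi> u) z = z \<longleftrightarrow> act ?P (\<phi>' (\<iota> u)) (x, y) = (x, y)"
        if u: "u \<in> carrier N" for u
      proof -
        have mem: "\<phi>' (\<iota> u) \<in> carrier (grp ?P)"
          using hom_in_carrier[OF \<phi>' hom_in_carrier[OF \<iota>(1) u]] .
        have "act ?V (?\<phi> u) z = ?b (act ?P (\<phi>' (\<iota> u)) (x, y))"
          unfolding zxy comp_def using V_simps(5)[OF mem xy] by simp
        then show ?thesis
          using inj_onD[OF inj_relabeling(4)[of UNIV], of "act ?P (\<phi>' (\<iota> u)) (x, y)" "(x, y)"]
          unfolding zxy by auto
      qed
      then have "\<iota> ` stab ?V N ?\<phi> z = ?S"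
        using \<iota>(2) by (auto simp: stab_def image_iff simp flip: \<iota>(2))
      then have eq: "?\<pi> ` stab ?V N ?\<phi> z = \<pi>' ` ?S" by (metis image_comp)
      show ?thesis
      proof (cases "has_fixed_point (\<pi> ` stab ?W H \<phi> x) B")
        case True
        then show ?thesis unfolding eq using has_fixed_point_mono sub[OF x y] by blast
      next
        case False
        have "finite (\<pi> ` stab ?W H \<phi> x)" using H(2) by (simp add: stab_def)
        then have "card (\<pi>' ` ?S) < card (\<pi> ` stab ?W H \<phi> x)"
          using sub[OF x y] ne[OF x y False] by (intro psubset_card_mono) auto
        then show ?thesis unfolding eq using small[OF x] False by simp
      qed
    qed
    moreover have "1 \<le> Suc n" by simp
    ultimately have "?good (Suc k) (Suc n) N ?\<phi> ?\<pi>" using N(1,2) \<phi>N \<pi>N by blast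
    then show ?case by - (intro exI, assumption)
  qed
  obtain n and H :: "nat monoid" and \<phi> \<pi> where n: "n \<ge> 1" and H: "group H" "finite (carrier H)"
    and \<phi>: "\<phi> \<in> hom H (grp (star_power A n))" and \<pi>: "\<pi> \<in> epi H ?G"
    and fixed: "\<And>x. x \<in> pts (star_power A n) \<Longrightarrow>
      has_fixed_point (\<pi> ` stab (star_power A n) H \<phi> x) B"
    using step[of "Suc (card (carrier ?G))"] by auto
  let ?W = "star_power A n"
  have W: "finite_gaction ?W" by (rule finite_gaction_star_power[OF A n])
  let ?X = "\<lparr>grp = H, pts = pts ?W, act = (\<lambda>h. act ?W (\<phi> h))\<rparr>"
  let ?Z = "\<lparr>grp = H, pts = pts B, act = (\<lambda>h. act B (\<pi> h))\<rparr>"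
  have X: "finite_gaction ?X" by (rule finite_gaction_pullback[OF W H \<phi>])
  have Z: "finite_gaction ?Z"
    using \<pi> by (intro finite_gaction_pullback[OF B H]) (simp add: epi_def)
  have "has_fixed_point {g \<in> carrier (grp ?X). act ?X g x = x} ?Z" if "x \<in> pts ?X" for x
    using fixed[of x] that by (auto simp: has_fixed_point_def stab_def)
  from equivariant_map_exists[OF X Z _ this]
  obtain e where e: "e \<in> pts ?W \<rightarrow> pts B"
    "\<And>h x. h \<in> carrier H \<Longrightarrow> x \<in> pts ?W \<Longrightarrow> e (act ?W (\<phi> h) x) = act B (\<pi> h) (e x)" by auto
  have "group_action H (pts B) (\<lambda>h. act B (\<pi> h))" using Z by (simp add: finite_gaction_def)
  moreover have "\<forall>h\<in>kernel H ?G \<pi>. \<forall>z\<in>pts B. act B (\<pi> h) z = z"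
    using B'(5) by (simp add: kernel_def)
  ultimately show ?thesis
    unfolding elem_implies_def using n H \<phi> \<pi> e
    by (intro exI[of _ n] conjI exI[of _ H] exI[of _ \<phi>] exI[of _ "\<lambda>h. act B (\<pi> h)"]
        exI[of _ e] exI[of _ \<pi>]) auto
qed

theorem elem_implies_iff_covers:
  assumes "finite_gaction A" "finite_gaction B"
  shows "elem_implies A B \<longleftrightarrow> (\<forall>T. subgroup T (grp B) \<and> \<not> has_fixed_point T B \<longrightarrow>
    covers A ((grp B)\<lparr>carrier := T\<rparr>))"
  using covers_imp_elem_implies[OF assms] elem_implies_imp_covers[OF assms] by blast

subsection \<open>Covered groups determine elementary implication\<close>

lemma covers_epi: "covers A T \<Longrightarrow> epi U T \<noteq> {} \<Longrightarrow> covers A U"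
  unfolding covers_def using epi_nonempty_trans by metis

lemma covers_subgroup:
  assumes "finite_gaction A" "subgroup S (grp A)" "\<not> has_fixed_point S A"
  shows "covers A ((grp A)\<lparr>carrier := S\<rparr>)"
  using frattini_coset_epi[OF group.subgroup_imp_group[OF finite_gactionD(1)[OF assms(1)] assms(2)]]
    assms(2,3) unfolding covers_def by blast

lemma covers_frattini_quotient:
  assumes "finite_gaction A" "group T" "covers A T"
  shows "covers A (frattini_quotient T)"
proof -
  obtain S where S: "subgroup S (grp A)" "\<not> has_fixed_point S A"
    "epi T (frattini_quotient ((grp A)\<lparr>carrier := S\<rparr>)) \<noteq> {}"
    using assms(3) unfolding covers_def by blast
  have "group ((grp A)\<lparr>carrier := S\<rparr>)"
    using group.subgroup_imp_group[OF finite_gactionD(1)[OF assms(1)] S(1)] .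
  then have "epi (frattini_quotient T) (frattini_quotient ((grp A)\<lparr>carrier := S\<rparr>)) \<noteq> {}"
    using S(3) assms(2)
    by (simp add: epi_from_frattini_quotient_iff group_frattini_quotient frattini_frattini_quotient
        del: one_frattini_quotient)
  then show ?thesis using S unfolding covers_def by blast
qed

text \<open>The subgroups of \<open>B\<close> in the characterization of elementary implication may be replaced by all
  groups covered by \<open>B\<close>.\<close>

lemma elem_implies_covers:
  assumes "finite_gaction A" "finite_gaction B" "elem_implies A B" "covers B T"
  shows "covers A T"
proof -
  obtain R where R: "subgroup R (grp B)" "\<not> has_fixed_point R B"
    "epi T (frattini_quotient ((grp B)\<lparr>carrier := R\<rparr>)) \<noteq> {}"
    using assms(4) unfolding covers_def by blast
  have "covers A ((grp B)\<lparr>carrier := R\<rparr>)"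
    using assms(1-3) R(1,2) elem_implies_iff_covers by blast
  then have "covers A (frattini_quotient ((grp B)\<lparr>carrier := R\<rparr>))"
    using covers_frattini_quotient[OF assms(1)]
      group.subgroup_imp_group[OF finite_gactionD(1)[OF assms(2)] R(1)] by blast
  then show ?thesis using R(3) covers_epi by blast
qed

lemma elem_impliesI:
  fixes A :: "('g, 'x) gaction" and B :: "('k, 'z) gaction"
  assumes "finite_gaction A" "finite_gaction B"
    and imp: "\<And>T :: 'k monoid. group T \<Longrightarrow> finite (carrier T) \<Longrightarrow> covers B T \<Longrightarrow> covers A T"
  shows "elem_implies A B"
proof -
  note B = finite_gactionD[OF assms(2)]
  have "covers A ((grp B)\<lparr>carrier := T\<rparr>)" if T: "subgroup T (grp B)" "\<not> has_fixed_point T B" for T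
    using imp[OF group.subgroup_imp_group[OF B(1) T(1)]] covers_subgroup[OF assms(2) T]
      finite_subset[OF subgroup.subset[OF T(1)] B(2)] by simp
  then show ?thesis using elem_implies_iff_covers[OF assms(1,2)] by blast
qed

lemma elem_equivI:
  fixes A :: "('g, 'x) gaction" and B :: "('k, 'z) gaction"
  assumes "finite_gaction A" "finite_gaction B"
    and "\<And>T :: 'k monoid. group T \<Longrightarrow> finite (carrier T) \<Longrightarrow> covers B T \<Longrightarrow> covers A T"
    and "\<And>T :: 'g monoid. group T \<Longrightarrow> finite (carrier T) \<Longrightarrow> covers A T \<Longrightarrow> covers B T"
  shows "elem_equiv A B"
  unfolding elem_equiv_def using assms by (blast intro: elem_impliesI)

lemma elem_equiv_refl: "finite_gaction A \<Longrightarrow> elem_equiv A A"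
  by (rule elem_equivI)

lemma elem_equiv_sym: "elem_equiv A B \<Longrightarrow> elem_equiv B A"
  by (simp add: elem_equiv_def)

lemma elem_implies_trans:
  assumes "finite_gaction A" "finite_gaction B" "finite_gaction C"
    and "elem_implies A B" "elem_implies B C"
  shows "elem_implies A C"
  by (rule elem_impliesI[OF assms(1,3)])
    (rule elem_implies_covers[OF assms(1,2,4)], rule elem_implies_covers[OF assms(2,3,5)])

lemma elem_equiv_trans:
  assumes "finite_gaction A" "finite_gaction B" "finite_gaction C"
    and "elem_equiv A B" "elem_equiv B C"
  shows "elem_equiv A C"
  using assms elem_implies_trans unfolding elem_equiv_def by metis

section \<open>The invariant and the covered groups\<close>

lemma chi_rE:
  assumes "finite_gaction A" "K \<in> chi_r A"
  obtains S where "subgroup S (grp A)" "\<not> has_fixed_point S A" "group K"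
    "group (frattini_quotient ((grp A)\<lparr>carrier := S\<rparr>))"
    "finite (carrier (frattini_quotient ((grp A)\<lparr>carrier := S\<rparr>)))"
    "K \<cong> frattini_quotient ((grp A)\<lparr>carrier := S\<rparr>)"
    "\<And>S' f. subgroup S' (grp A) \<Longrightarrow> \<not> has_fixed_point S' A \<Longrightarrow>
      f \<in> epi (frattini_quotient ((grp A)\<lparr>carrier := S\<rparr>))
              (frattini_quotient ((grp A)\<lparr>carrier := S'\<rparr>)) \<Longrightarrow>
      f \<in> iso (frattini_quotient ((grp A)\<lparr>carrier := S\<rparr>))
              (frattini_quotient ((grp A)\<lparr>carrier := S'\<rparr>))"
proof -
  note A = finite_gactionD[OF assms(1)]
  obtain S where S: "subgroup S (grp A)" "\<not> has_fixed_point S A" "group K"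
    "K \<cong> frattini_quotient ((grp A)\<lparr>carrier := S\<rparr>)"
    and mn: "\<not> (\<exists>S'. subgroup S' (grp A) \<and> \<not> has_fixed_point S' A \<and>
      (\<exists>f \<in> epi (frattini_quotient ((grp A)\<lparr>carrier := S\<rparr>))
              (frattini_quotient ((grp A)\<lparr>carrier := S'\<rparr>)).
         f \<notin> iso (frattini_quotient ((grp A)\<lparr>carrier := S\<rparr>))
              (frattini_quotient ((grp A)\<lparr>carrier := S'\<rparr>))))"
    using assms(2) unfolding chi_r_def Let_def by blast
  have "group (frattini_quotient ((grp A)\<lparr>carrier := S\<rparr>))"
    using group_frattini_quotient[OF group.subgroup_imp_group[OF A(1) S(1)]] .
  moreover have "finite (carrier (frattini_quotient ((grp A)\<lparr>carrier := S\<rparr>)))"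
    using finite_subset[OF subgroup.subset[OF S(1)] A(2)]
    by (intro finite_frattini_quotient) simp
  ultimately show thesis using that[OF S(1-3) _ _ S(4)] mn by blast
qed

text \<open>The groups in the invariant are the minimal ones among the Frattini quotients of fixed-point
  free subgroups, so they detect the covered groups.\<close>

lemma covers_iff_chi_r:
  assumes "finite_gaction A"
  shows "covers A T \<longleftrightarrow> (\<exists>K\<in>chi_r A. epi T K \<noteq> {})"
proof
  note A = finite_gactionD[OF assms]
  let ?Q = "\<lambda>S. frattini_quotient ((grp A)\<lparr>carrier := S\<rparr>)"
  have grp_Q: "group (?Q S)" and fin_Q: "finite (carrier (?Q S))" if "subgroup S (grp A)" for S
    using group_frattini_quotient[OF group.subgroup_imp_group[OF A(1) that]]
      finite_frattini_quotient[of "(grp A)\<lparr>carrier := S\<rparr>"]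
      finite_subset[OF subgroup.subset[OF that] A(2)] by simp_all
  show "\<exists>K\<in>chi_r A. epi T K \<noteq> {}" if cov: "covers A T"
  proof -
    obtain S where S: "subgroup S (grp A)" "\<not> has_fixed_point S A" "epi T (?Q S) \<noteq> {}"
      using cov unfolding covers_def by blast
    let ?P = "\<lambda>R. subgroup R (grp A) \<and> \<not> has_fixed_point R A \<and> epi (?Q S) (?Q R) \<noteq> {}"
    have "?P S" using S(1,2) iso_imp_epi[OF iso_refl] by blast
    from ex_has_least_nat[of ?P S "\<lambda>R. card (carrier (?Q R))", OF this]
    obtain R where R_least: "?P R \<and>
        (\<forall>R'. ?P R' \<longrightarrow> card (carrier (?Q R)) \<le> card (carrier (?Q R')))"
      by (elim exE)
    note R = conjunct1[OF R_least] and least = conjunct2[OF R_least]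
    have mn: "f \<in> iso (?Q R) (?Q R')"
      if R': "subgroup R' (grp A)" "\<not> has_fixed_point R' A" and f: "f \<in> epi (?Q R) (?Q R')" for R' f
    proof -
      have "epi (?Q R) (?Q R') \<noteq> {}" using f by blast
      then have "epi (?Q S) (?Q R') \<noteq> {}" using R epi_nonempty_trans by metis
      then have "card (carrier (?Q R)) \<le> card (carrier (?Q R'))" using least R' by blast
      then have "card (carrier (?Q R)) \<le> card (f ` carrier (?Q R))" using f by (simp add: epi_def)
      then have "inj_on f (carrier (?Q R))"
        using fin_Q[of R] R by (simp add: eq_card_imp_inj_on card_image_le le_antisym)
      then show ?thesis using f by (simp add: iso_iff_mon_epi mon_def epi_def)
    qed
    obtain K :: "nat monoid" and g where K: "group K" "finite (carrier K)" "g \<in> iso K (?Q R)"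
      using nat_copy[OF grp_Q[OF conjunct1[OF R]] fin_Q[OF conjunct1[OF R]]] .
    have KQ: "K \<cong> ?Q R" using K(3) by (rule is_isoI)
    then have "K \<in> chi_r A" unfolding chi_r_def Let_def using K(1) R mn by blast
    moreover have "epi (?Q R) K \<noteq> {}" using iso_imp_epi[OF group.iso_sym[OF K(1) KQ]] .
    then have "epi T K \<noteq> {}" using S(3) R epi_nonempty_trans by metis
    ultimately show ?thesis by blast
  qed
  show "covers A T" if ex: "\<exists>K\<in>chi_r A. epi T K \<noteq> {}"
  proof -
    obtain K where K: "K \<in> chi_r A" "epi T K \<noteq> {}" using ex by blast
    obtain S where S: "subgroup S (grp A)" "\<not> has_fixed_point S A" "K \<cong> ?Q S"
      using chi_rE[OF assms K(1)] by metis
    then show ?thesis unfolding covers_def using S(1,2) epi_nonempty_trans[OF K(2) iso_imp_epi[OF S(3)]] by blast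
  qed
qed

lemma iso_reps_chi_r_exists:
  assumes "finite_gaction A"
  shows "\<exists>M. iso_reps (chi_r A) M"
proof -
  have gr: "group K" if "K \<in> chi_r A" for K using that by (simp add: chi_r_def Let_def)
  let ?r = "{(K, L). K \<in> chi_r A \<and> L \<in> chi_r A \<and> K \<cong> L}"
  have "equiv (chi_r A) ?r"
  proof (rule equivI)
    show "sym ?r" using gr by (auto simp: sym_def intro: group.iso_sym)
    show "trans ?r" by (auto simp: trans_def intro: iso_trans)
  qed (auto simp: refl_on_def)
  from representatives_exist[OF this] obtain M
    where M: "M \<subseteq> chi_r A" "\<forall>K\<in>chi_r A. \<exists>!L. L \<in> M \<and> (K, L) \<in> ?r"
    by (elim exE conjE)
  have "\<exists>!L. L \<in> M \<and> K \<cong> L" if "K \<in> chi_r A" for K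
    using M(1) bspec[OF M(2) that] that by (simp add: subset_iff) metis
  then have "iso_reps (chi_r A) M" using M(1) unfolding iso_reps_def by simp
  then show ?thesis by (rule exI)
qed

lemma covers_iff_iso_reps:
  assumes "finite_gaction A" "iso_reps (chi_r A) M"
  shows "covers A T \<longleftrightarrow> (\<exists>K\<in>M. epi T K \<noteq> {})"
proof -
  have sub: "M \<subseteq> chi_r A" and rep: "\<And>K. K \<in> chi_r A \<Longrightarrow> \<exists>L. L \<in> M \<and> K \<cong> L"
    using assms(2) unfolding iso_reps_def by (simp, metis)
  have "\<exists>L\<in>M. epi T L \<noteq> {}" if K: "K \<in> chi_r A" "epi T K \<noteq> {}" for K
  proof -
    obtain L where "L \<in> M" "K \<cong> L" using rep[OF K(1)] by metis
    then show ?thesis using epi_nonempty_trans[OF K(2) iso_imp_epi] by metis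
  qed
  then show ?thesis using covers_iff_chi_r[OF assms(1), of T] sub by (metis subsetD)
qed

text \<open>A set of representatives is finite because non-isomorphic members stem from distinct subgroups.
  An epimorphism between two members is an isomorphism by minimality, so they are equal.\<close>

lemma admissible_iso_reps:
  assumes A: "finite_gaction A" and M: "iso_reps (chi_r A) M"
  shows "admissible M"
proof -
  note A' = finite_gactionD[OF A]
  let ?Q = "\<lambda>S. frattini_quotient ((grp A)\<lparr>carrier := S\<rparr>)"
  have sub: "M \<subseteq> chi_r A" and uniq: "\<And>K L. K \<in> M \<Longrightarrow> L \<in> M \<Longrightarrow> K \<cong> L \<Longrightarrow> K = L"
    using M iso_refl unfolding iso_reps_def by blast+
  have "\<exists>S. subgroup S (grp A) \<and> K \<cong> ?Q S" if "K \<in> M" for K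
    using chi_rE[OF A] sub that by (metis subsetD)
  then obtain S where S: "\<And>K. K \<in> M \<Longrightarrow> subgroup (S K) (grp A)" "\<And>K. K \<in> M \<Longrightarrow> K \<cong> ?Q (S K)"
    by metis
  have gr: "group K" if "K \<in> M" for K using that sub by (auto simp: chi_r_def Let_def)
  have "inj_on S M"
  proof (rule inj_onI)
    fix K L assume KL: "K \<in> M" "L \<in> M" "S K = S L"
    have "?Q (S L) \<cong> L" using group.iso_sym[OF gr[OF KL(2)] S(2)[OF KL(2)]] .
    then have "K \<cong> L" using iso_trans[OF S(2)[OF KL(1)]] KL(3) by simp
    then show "K = L" using uniq KL by blast
  qed
  moreover have "S ` M \<subseteq> Pow (carrier (grp A))" using S(1) subgroup.subset by blast
  ultimately have "finite M" using A'(2) by (meson finite_Pow_iff finite_imageD finite_subset)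
  moreover have "group K \<and> finite (carrier K) \<and> frattini K = {\<one>\<^bsub>K\<^esub>}" if K: "K \<in> M" for K
  proof -
    have KA: "K \<in> chi_r A" using sub K by blast
    obtain R where R: "subgroup R (grp A)" "group (?Q R)" "finite (carrier (?Q R))" "K \<cong> ?Q R"
      using chi_rE[OF A KA] by metis
    have "frattini (?Q R) = {\<one>\<^bsub>?Q R\<^esub>}"
      using frattini_frattini_quotient group.subgroup_imp_group[OF A'(1) R(1)] by blast
    then show ?thesis
      using frattini_trivial_iso[OF gr[OF K] R(2,4)] iso_finite[OF R(4)] R(3) gr[OF K] by blast
  qed
  moreover have "epi K L = {}" if KL: "K \<in> M" "L \<in> M" "K \<noteq> L" for K L
  proof (rule ccontr)
    assume ne: "epi K L \<noteq> {}"
    have KA: "K \<in> chi_r A" "L \<in> chi_r A" using sub KL by blast+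
    obtain R where R: "K \<cong> ?Q R" and mn: "\<And>S' f. subgroup S' (grp A) \<Longrightarrow> \<not> has_fixed_point S' A \<Longrightarrow>
      f \<in> epi (?Q R) (?Q S') \<Longrightarrow> f \<in> iso (?Q R) (?Q S')"
      using chi_rE[OF A KA(1)] by metis
    obtain R' where R': "subgroup R' (grp A)" "\<not> has_fixed_point R' A" "L \<cong> ?Q R'"
      using chi_rE[OF A KA(2)] by metis
    have "epi (?Q R) K \<noteq> {}" using iso_imp_epi[OF group.iso_sym[OF gr[OF KL(1)] R]] .
    then have "epi (?Q R) (?Q R') \<noteq> {}"
      using ne iso_imp_epi[OF R'(3)] epi_nonempty_trans by metis
    then have "?Q R \<cong> ?Q R'" using mn R'(1,2) is_isoI by blast
    moreover have "?Q R' \<cong> L" using group.iso_sym[OF gr[OF KL(2)] R'(3)] .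
    ultimately have "?Q R \<cong> L" by (rule iso_trans)
    then have "K \<cong> L" by (rule iso_trans[OF R])
    then show False using uniq KL by blast
  qed
  ultimately show ?thesis unfolding admissible_def by blast
qed

section \<open>Primitive actions and external products\<close>

lemma conj_image:
  fixes G (structure)
  shows "g <# M #> h = (\<lambda>m. g \<otimes> m \<otimes> h) ` M"
  by (auto simp: l_coset_def r_coset_def)

lemma conjugate_in_equiv:
  assumes "group G"
  shows "equiv {M. maximal_subgroup M G}
    {(M, N). maximal_subgroup M G \<and> maximal_subgroup N G \<and> conjugate_in G M N}"
proof -
  interpret group G by fact
  have sub: "M \<subseteq> carrier G" if "maximal_subgroup M G" for M
    using that subgroup.subset by (auto simp: maximal_subgroup_def)
  have refl: "conjugate_in G M M" if "maximal_subgroup M G" for M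
  proof -
    have "M = (\<lambda>m. \<one>\<^bsub>G\<^esub> \<otimes>\<^bsub>G\<^esub> m \<otimes>\<^bsub>G\<^esub> inv\<^bsub>G\<^esub> \<one>\<^bsub>G\<^esub>) ` M"
      using sub[OF that] by (force simp: image_iff)
    then show ?thesis unfolding conjugate_in_def conj_image by blast
  qed
  have sym: "conjugate_in G N M" if M: "maximal_subgroup M G" and MN: "conjugate_in G M N" for M N
  proof -
    obtain g where g: "g \<in> carrier G" "N = (\<lambda>m. g \<otimes>\<^bsub>G\<^esub> m \<otimes>\<^bsub>G\<^esub> inv\<^bsub>G\<^esub> g) ` M"
      using MN unfolding conjugate_in_def conj_image by blast
    have "inv\<^bsub>G\<^esub> g \<otimes>\<^bsub>G\<^esub> (g \<otimes>\<^bsub>G\<^esub> m \<otimes>\<^bsub>G\<^esub> inv\<^bsub>G\<^esub> g) \<otimes>\<^bsub>G\<^esub> inv\<^bsub>G\<^esub> (inv\<^bsub>G\<^esub> g) = m" if "m \<in> M" for m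
    proof -
      have m: "m \<in> carrier G" using that sub[OF M] by blast
      have "inv\<^bsub>G\<^esub> g \<otimes>\<^bsub>G\<^esub> (g \<otimes>\<^bsub>G\<^esub> m) = m"
        using m_assoc[of "inv\<^bsub>G\<^esub> g" g m] m g(1) by simp
      then show ?thesis using m g(1) by (simp add: m_assoc)
    qed
    then have "M = (\<lambda>m. inv\<^bsub>G\<^esub> g \<otimes>\<^bsub>G\<^esub> m \<otimes>\<^bsub>G\<^esub> inv\<^bsub>G\<^esub> (inv\<^bsub>G\<^esub> g)) ` N"
      by (simp add: g(2) image_image)
    then show ?thesis using g(1) unfolding conjugate_in_def conj_image by blast
  qed
  have trans: "conjugate_in G M K"
    if M: "maximal_subgroup M G" and MN: "conjugate_in G M N" and NK: "conjugate_in G N K" for M N K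
  proof -
    obtain g where g: "g \<in> carrier G" "N = (\<lambda>m. g \<otimes>\<^bsub>G\<^esub> m \<otimes>\<^bsub>G\<^esub> inv\<^bsub>G\<^esub> g) ` M"
      using MN unfolding conjugate_in_def conj_image by blast
    obtain h where h: "h \<in> carrier G" "K = (\<lambda>m. h \<otimes>\<^bsub>G\<^esub> m \<otimes>\<^bsub>G\<^esub> inv\<^bsub>G\<^esub> h) ` N"
      using NK unfolding conjugate_in_def conj_image by blast
    have "h \<otimes>\<^bsub>G\<^esub> (g \<otimes>\<^bsub>G\<^esub> m \<otimes>\<^bsub>G\<^esub> inv\<^bsub>G\<^esub> g) \<otimes>\<^bsub>G\<^esub> inv\<^bsub>G\<^esub> h
        = (h \<otimes>\<^bsub>G\<^esub> g) \<otimes>\<^bsub>G\<^esub> m \<otimes>\<^bsub>G\<^esub> inv\<^bsub>G\<^esub> (h \<otimes>\<^bsub>G\<^esub> g)" if "m \<in> M" for m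
    proof -
      have "m \<in> carrier G" using that sub[OF M] by blast
      then show ?thesis using g(1) h(1) by (simp add: m_assoc inv_mult_group)
    qed
    then have "K = (\<lambda>m. (h \<otimes>\<^bsub>G\<^esub> g) \<otimes>\<^bsub>G\<^esub> m \<otimes>\<^bsub>G\<^esub> inv\<^bsub>G\<^esub> (h \<otimes>\<^bsub>G\<^esub> g)) ` M"
      by (simp add: g(2) h(2) image_image)
    then show ?thesis using g(1) h(1) unfolding conjugate_in_def conj_image by blast
  qed
  show ?thesis
  proof (rule equivI)
    show "sym {(M, N). maximal_subgroup M G \<and> maximal_subgroup N G \<and> conjugate_in G M N}"
      using sym by (auto simp: sym_def)
    show "trans {(M, N). maximal_subgroup M G \<and> maximal_subgroup N G \<and> conjugate_in G M N}"
      unfolding trans_def using trans by blast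
  qed (auto simp: refl_on_def refl)
qed

lemma maximal_reps:
  assumes "group G"
  shows "\<And>N. N \<in> maximal_reps G \<Longrightarrow> maximal_subgroup N G"
    and "\<And>M. maximal_subgroup M G \<Longrightarrow> \<exists>N\<in>maximal_reps G. conjugate_in G M N"
proof -
  let ?P = "\<lambda>R. (\<forall>N\<in>R. maximal_subgroup N G) \<and>
    (\<forall>M. maximal_subgroup M G \<longrightarrow> (\<exists>!N. N \<in> R \<and> conjugate_in G M N))"
  from representatives_exist[OF conjugate_in_equiv[OF assms]]
  obtain R where R: "R \<subseteq> {M. maximal_subgroup M G}"
    "\<forall>M \<in> {M. maximal_subgroup M G}. \<exists>!N. N \<in> R \<and>
      (M, N) \<in> {(M, N). maximal_subgroup M G \<and> maximal_subgroup N G \<and> conjugate_in G M N}"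
    by (elim exE conjE)
  have "\<exists>!N. N \<in> R \<and> conjugate_in G M N" if "maximal_subgroup M G" for M
    using R(2) that R(1) by (simp add: subset_iff) metis
  then have "?P R" using R(1) by blast
  then have "?P (maximal_reps G)" unfolding maximal_reps_def by (rule someI)
  then show "\<And>N. N \<in> maximal_reps G \<Longrightarrow> maximal_subgroup N G"
    "\<And>M. maximal_subgroup M G \<Longrightarrow> \<exists>N\<in>maximal_reps G. conjugate_in G M N" by auto
qed

lemma prim_action_simps:
  "grp (prim_action G) = G"
  "pts (prim_action G) = Sigma (maximal_reps G) (\<lambda>M. lcosets\<^bsub>G\<^esub> M)"
  "(M, K) \<in> pts (prim_action G) \<Longrightarrow> act (prim_action G) g (M, K) = (M, g <#\<^bsub>G\<^esub> K)"
  "act (prim_action G) g \<in> extensional (pts (prim_action G))"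
  by (auto simp: prim_action_def Let_def)

lemma finite_gaction_prim_action:
  assumes "group G" "finite (carrier G)"
  shows "finite_gaction (prim_action G)"
proof -
  interpret group G by fact
  let ?A = "prim_action G"
  have sub: "M \<subseteq> carrier G" if "M \<in> maximal_reps G" for M
    using maximal_reps(1)[OF assms(1) that] subgroup.subset by (auto simp: maximal_subgroup_def)
  have ptsE: "\<exists>M a. M \<in> maximal_reps G \<and> a \<in> carrier G \<and> x = (M, a <#\<^bsub>G\<^esub> M)"
    if "x \<in> pts ?A" for x
    using that by (auto simp: prim_action_simps LCOSETS_def)
  have ptsI: "(M, a <#\<^bsub>G\<^esub> M) \<in> pts ?A" if "M \<in> maximal_reps G" "a \<in> carrier G" for M a
    using that by (auto simp: prim_action_simps LCOSETS_def)
  have actE: "act ?A g (M, a <#\<^bsub>G\<^esub> M) = (M, (g \<otimes>\<^bsub>G\<^esub> a) <#\<^bsub>G\<^esub> M)"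
    if "M \<in> maximal_reps G" "a \<in> carrier G" "g \<in> carrier G" for M a g
    using prim_action_simps(3)[OF ptsI[OF that(1,2)], of g] lcos_m_assoc[OF sub[OF that(1)] that(3,2)]
    by simp
  have "group_action G (pts ?A) (act ?A)"
  proof (rule group_actionI[OF assms(1)])
    fix g x assume "g \<in> carrier G" "x \<in> pts ?A"
    then show "act ?A g x \<in> pts ?A" using ptsE ptsI actE by (metis m_closed)
  next
    fix x assume "x \<in> pts ?A"
    then show "act ?A \<one>\<^bsub>G\<^esub> x = x" using ptsE actE by (metis l_one one_closed)
  next
    fix g h x assume "g \<in> carrier G" "h \<in> carrier G" "x \<in> pts ?A"
    then show "act ?A (g \<otimes>\<^bsub>G\<^esub> h) x = act ?A g (act ?A h x)"
      using ptsE actE by (metis m_assoc m_closed)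
  qed (rule prim_action_simps)
  moreover have "finite (pts ?A)"
  proof (rule finite_subset)
    show "pts ?A \<subseteq> Pow (carrier G) \<times> Pow (carrier G)"
    proof
      fix x assume "x \<in> pts ?A"
      then obtain M a where "M \<in> maximal_reps G" "a \<in> carrier G" "x = (M, a <#\<^bsub>G\<^esub> M)"
        using ptsE by metis
      then show "x \<in> Pow (carrier G) \<times> Pow (carrier G)"
        using sub[of M] l_coset_subset_G[OF sub[of M], of a] by simp
    qed
  qed (use assms(2) in simp)
  ultimately show ?thesis using assms(2) by (simp add: finite_gaction_def prim_action_simps(1))
qed

text \<open>The stabilizers of the points are the maximal subgroups, so among all subgroups only the
  whole group has no fixed point.\<close>

lemma prim_action_has_fixed_point:
  assumes "group G" "finite (carrier G)" "subgroup T G"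
  shows "has_fixed_point T (prim_action G) \<longleftrightarrow> T \<noteq> carrier G"
proof
  interpret group G by fact
  let ?A = "prim_action G"
  have Tsub: "T \<subseteq> carrier G" using assms(3) by (rule subgroup.subset)
  have max: "subgroup M G" "M \<noteq> carrier G" "M \<subseteq> carrier G" if "M \<in> maximal_reps G" for M
    using maximal_reps(1)[OF assms(1) that] subgroup.subset by (auto simp: maximal_subgroup_def)
  show "T \<noteq> carrier G" if fp: "has_fixed_point T ?A"
  proof
    assume T: "T = carrier G"
    obtain M a where M: "M \<in> maximal_reps G" and a: "a \<in> carrier G"
      and fix_a: "\<And>t. t \<in> carrier G \<Longrightarrow> act ?A t (M, a <#\<^bsub>G\<^esub> M) = (M, a <#\<^bsub>G\<^esub> M)"
      and pt: "(M, a <#\<^bsub>G\<^esub> M) \<in> pts ?A"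
      using fp unfolding T has_fixed_point_def by (auto simp: prim_action_simps(2) LCOSETS_def)
    have "g \<in> M" if g: "g \<in> carrier G" for g
    proof -
      let ?t = "a \<otimes>\<^bsub>G\<^esub> g \<otimes>\<^bsub>G\<^esub> inv\<^bsub>G\<^esub> a"
      have t: "?t \<in> carrier G" using a g by simp
      have ta: "?t \<otimes>\<^bsub>G\<^esub> a = a \<otimes>\<^bsub>G\<^esub> g" using a g by (simp add: m_assoc)
      have "?t <#\<^bsub>G\<^esub> (a <#\<^bsub>G\<^esub> M) = a <#\<^bsub>G\<^esub> M"
        using fix_a[OF t] prim_action_simps(3)[OF pt] by simp
      then have "(a \<otimes>\<^bsub>G\<^esub> g) <#\<^bsub>G\<^esub> M = a <#\<^bsub>G\<^esub> M"
        using lcos_m_assoc[OF max(3)[OF M] t a] ta by simp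
      moreover have "a \<otimes>\<^bsub>G\<^esub> g \<in> (a \<otimes>\<^bsub>G\<^esub> g) <#\<^bsub>G\<^esub> M"
        using subgroup.one_closed[OF max(1)[OF M]] a g by (force simp: l_coset_def)
      ultimately obtain m where "m \<in> M" "a \<otimes>\<^bsub>G\<^esub> g = a \<otimes>\<^bsub>G\<^esub> m" by (auto simp: l_coset_def)
      then show "g \<in> M" using a g max(3)[OF M] by (metis l_cancel subsetD)
    qed
    then show False using max(2,3)[OF M] by blast
  qed
  show "has_fixed_point T ?A" if proper: "T \<noteq> carrier G"
  proof -
    obtain M where M: "maximal_subgroup M G" "T \<subseteq> M"
      using proper_subgroup_in_maximal[OF assms proper] .
    then obtain N g where N: "N \<in> maximal_reps G" and g: "g \<in> carrier G"
      and NM: "N = (\<lambda>m. g \<otimes>\<^bsub>G\<^esub> m \<otimes>\<^bsub>G\<^esub> inv\<^bsub>G\<^esub> g) ` M"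
      using maximal_reps(2)[OF assms(1) M(1)] unfolding conjugate_in_def conj_image by blast
    let ?i = "inv\<^bsub>G\<^esub> g"
    have pt: "(N, ?i <#\<^bsub>G\<^esub> N) \<in> pts ?A"
      using N g by (auto simp: prim_action_simps(2) LCOSETS_def)
    have "act ?A t (N, ?i <#\<^bsub>G\<^esub> N) = (N, ?i <#\<^bsub>G\<^esub> N)" if t: "t \<in> T" for t
    proof -
      have tc: "t \<in> carrier G" using t Tsub by blast
      let ?n = "g \<otimes>\<^bsub>G\<^esub> t \<otimes>\<^bsub>G\<^esub> ?i"
      have n: "?n \<in> N" "?n \<in> carrier G" using t M(2) NM tc g by auto
      have "t <#\<^bsub>G\<^esub> (?i <#\<^bsub>G\<^esub> N) = (t \<otimes>\<^bsub>G\<^esub> ?i) <#\<^bsub>G\<^esub> N"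
        using lcos_m_assoc[OF max(3)[OF N] tc] g by simp
      also have "t \<otimes>\<^bsub>G\<^esub> ?i = ?i \<otimes>\<^bsub>G\<^esub> ?n" using g tc by (simp add: m_assoc[symmetric])
      also have "(?i \<otimes>\<^bsub>G\<^esub> ?n) <#\<^bsub>G\<^esub> N = ?i <#\<^bsub>G\<^esub> (?n <#\<^bsub>G\<^esub> N)"
        using lcos_m_assoc[OF max(3)[OF N] _ n(2)] g by simp
      also have "?n <#\<^bsub>G\<^esub> N = N" using coset_join3[OF n(2) max(1)[OF N] n(1)] .
      finally show ?thesis using prim_action_simps(3)[OF pt] by simp
    qed
    then show ?thesis using pt unfolding has_fixed_point_def by blast
  qed
qed

subsection \<open>External products\<close>

lemma ext_prod_simps:
  "grp (ext_prod I F) = product_group I (\<lambda>i. grp (F i))"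
  "pts (ext_prod I F) = (\<Pi>\<^sub>E i\<in>I. pts (F i))"
  "x \<in> pts (ext_prod I F) \<Longrightarrow> act (ext_prod I F) g x = (\<lambda>i\<in>I. act (F i) (g i) (x i))"
  "act (ext_prod I F) g \<in> extensional (pts (ext_prod I F))"
  by (auto simp: ext_prod_def)

lemma finite_gaction_ext_prod:
  assumes "finite I" and F: "\<And>i. i \<in> I \<Longrightarrow> finite_gaction (F i)"
  shows "finite_gaction (ext_prod I F)"
proof -
  note D = finite_gactionD[OF F]
  let ?P = "ext_prod I F"
  have gr: "group (grp ?P)" using D(1) by (simp add: ext_prod_simps)
  have mem: "g i \<in> carrier (grp (F i))" if "g \<in> carrier (grp ?P)" "i \<in> I" for g i
    using that by (auto simp: ext_prod_simps)
  have pmem: "x i \<in> pts (F i)" if "x \<in> pts ?P" "i \<in> I" for x i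
    using that by (auto simp: ext_prod_simps)
  have cl: "act ?P g x \<in> pts ?P" if "g \<in> carrier (grp ?P)" "x \<in> pts ?P" for g x
    using that D(4) mem[OF that(1)] pmem[OF that(2)] unfolding ext_prod_simps(3)[OF that(2)]
    by (auto simp: ext_prod_simps(2))
  have "group_action (grp ?P) (pts ?P) (act ?P)"
  proof (rule group_actionI[OF gr])
    fix x assume x: "x \<in> pts ?P"
    then have ext: "x \<in> extensional I" by (simp add: ext_prod_simps PiE_def)
    show "act ?P \<one>\<^bsub>grp ?P\<^esub> x = x"
      unfolding ext_prod_simps(3)[OF x]
      by (rule extensionalityI[OF _ ext]) (use D(5) pmem[OF x] in \<open>auto simp: ext_prod_simps\<close>)
  next
    fix g h x assume gh: "g \<in> carrier (grp ?P)" "h \<in> carrier (grp ?P)" and x: "x \<in> pts ?P"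
    show "act ?P (g \<otimes>\<^bsub>grp ?P\<^esub> h) x = act ?P g (act ?P h x)"
    proof -
      have "act ?P (g \<otimes>\<^bsub>grp ?P\<^esub> h) x = (\<lambda>i\<in>I. act (F i) (g i) (act ?P h x i))"
        unfolding ext_prod_simps(3)[OF x]
        using D(6) mem[OF gh(1)] mem[OF gh(2)] pmem[OF x]
        by (auto simp: ext_prod_simps(1) intro!: restrict_ext)
      then show ?thesis using ext_prod_simps(3)[OF cl[OF gh(2) x]] by simp
    qed
  qed (use cl ext_prod_simps(4) in auto)
  moreover have "finite (carrier (grp ?P))" "finite (pts ?P)"
    using D(2,3) assms(1) by (auto simp: ext_prod_simps intro!: finite_PiE)
  ultimately show ?thesis by (simp add: finite_gaction_def)
qed

lemma ext_prod_has_fixed_point: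
  assumes "S \<subseteq> carrier (grp (ext_prod I F))"
  shows "has_fixed_point S (ext_prod I F) \<longleftrightarrow> (\<forall>i\<in>I. has_fixed_point ((\<lambda>g. g i) ` S) (F i))"
proof
  assume "has_fixed_point S (ext_prod I F)"
  then obtain x where x: "x \<in> pts (ext_prod I F)"
    "\<And>g. g \<in> S \<Longrightarrow> act (ext_prod I F) g x = x" by (auto simp: has_fixed_point_def)
  show "\<forall>i\<in>I. has_fixed_point ((\<lambda>g. g i) ` S) (F i)"
  proof
    fix i assume i: "i \<in> I"
    have "act (F i) (g i) (x i) = x i" if "g \<in> S" for g
      using fun_cong[OF x(2)[OF that], of i] i unfolding ext_prod_simps(3)[OF x(1)] by simp
    moreover have "x i \<in> pts (F i)" using x(1) i by (auto simp: ext_prod_simps)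
    ultimately show "has_fixed_point ((\<lambda>g. g i) ` S) (F i)" by (auto simp: has_fixed_point_def)
  qed
next
  assume "\<forall>i\<in>I. has_fixed_point ((\<lambda>g. g i) ` S) (F i)"
  then have "\<forall>i\<in>I. \<exists>y. y \<in> pts (F i) \<and> (\<forall>g\<in>S. act (F i) (g i) y = y)"
    by (auto simp: has_fixed_point_def)
  from bchoice[OF this] obtain x where
    x: "\<And>i. i \<in> I \<Longrightarrow> x i \<in> pts (F i)" "\<And>i g. i \<in> I \<Longrightarrow> g \<in> S \<Longrightarrow> act (F i) (g i) (x i) = x i"
    by blast
  have pt: "restrict x I \<in> pts (ext_prod I F)" using x(1) by (simp add: ext_prod_simps)
  have "act (ext_prod I F) g (restrict x I) = restrict x I" if "g \<in> S" for g
    unfolding ext_prod_simps(3)[OF pt] using x(2)[OF _ that] by (auto intro!: restrict_ext)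
  then show "has_fixed_point S (ext_prod I F)" using pt unfolding has_fixed_point_def by blast
qed

text \<open>A subgroup of a product of primitive actions has no fixed point if and only if one of its
  projections is surjective.\<close>

lemma covers_ext_prod_prim_action:
  assumes "finite I"
    and F: "\<And>i. i \<in> I \<Longrightarrow> F i = prim_action (grp (F i))"
    and K: "\<And>i. i \<in> I \<Longrightarrow> group (grp (F i))" "\<And>i. i \<in> I \<Longrightarrow> finite (carrier (grp (F i)))"
      "\<And>i. i \<in> I \<Longrightarrow> frattini (grp (F i)) = {\<one>\<^bsub>grp (F i)\<^esub>}"
  shows "covers (ext_prod I F) T \<longleftrightarrow> (\<exists>i\<in>I. epi T (grp (F i)) \<noteq> {})"
proof
  let ?P = "ext_prod I F"
  have gP: "group (grp ?P)" using K(1) by (simp add: ext_prod_simps)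
  have proj: "group_hom (grp ?P) (grp (F i)) (\<lambda>g. g i)" if "i \<in> I" for i
    using gP K(1) that by (auto simp: group_hom_iff hom_def ext_prod_simps)
  have fp: "has_fixed_point S ?P \<longleftrightarrow> (\<forall>i\<in>I. (\<lambda>g. g i) ` S \<noteq> carrier (grp (F i)))"
    if S: "subgroup S (grp ?P)" for S
  proof -
    have "has_fixed_point ((\<lambda>g. g i) ` S) (F i) \<longleftrightarrow> (\<lambda>g. g i) ` S \<noteq> carrier (grp (F i))"
      if i: "i \<in> I" for i
      using prim_action_has_fixed_point[OF K(1,2) group_hom.subgroup_img_is_subgroup[OF proj S]] i
      by (simp flip: F)
    then show ?thesis using ext_prod_has_fixed_point[OF subgroup.subset[OF S]] by simp
  qed
  show "\<exists>i\<in>I. epi T (grp (F i)) \<noteq> {}" if cov: "covers ?P T"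
  proof -
    obtain S where S: "subgroup S (grp ?P)" "\<not> has_fixed_point S ?P"
      "epi T (frattini_quotient ((grp ?P)\<lparr>carrier := S\<rparr>)) \<noteq> {}"
      using cov unfolding covers_def by blast
    let ?S = "(grp ?P)\<lparr>carrier := S\<rparr>"
    obtain i where i: "i \<in> I" "(\<lambda>g. g i) ` S = carrier (grp (F i))" using fp[OF S(1)] S(2) by blast
    have gS: "group ?S" using group.subgroup_imp_group[OF gP S(1)] .
    have "(\<lambda>g. g i) \<in> epi ?S (grp (F i))"
      using group_hom.induced_group_hom'[OF proj[OF i(1)] S(1)] i(2)
      by (simp add: epi_def group_hom_iff)
    then have "epi (frattini_quotient ?S) (grp (F i)) \<noteq> {}"
      using epi_from_frattini_quotient_iff[OF gS K(1,3)] i(1) by blast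
    then show ?thesis using i(1) S(3) epi_nonempty_trans by metis
  qed
  show "covers ?P T" if ex: "\<exists>i\<in>I. epi T (grp (F i)) \<noteq> {}"
  proof -
    obtain i where i: "i \<in> I" "epi T (grp (F i)) \<noteq> {}" using ex by blast
    define \<iota> where "\<iota> k = (\<lambda>j\<in>I. if j = i then k else \<one>\<^bsub>grp (F j)\<^esub>)" for k
    have \<iota>: "group_hom (grp (F i)) (grp ?P) \<iota>"
      unfolding group_hom_iff
    proof (intro conjI homI)
      fix k l assume kl: "k \<in> carrier (grp (F i))" "l \<in> carrier (grp (F i))"
      show "\<iota> k \<in> carrier (grp ?P)"
        using kl K(1) by (auto simp: \<iota>_def ext_prod_simps group.is_monoid)
      show "\<iota> (k \<otimes>\<^bsub>grp (F i)\<^esub> l) = \<iota> k \<otimes>\<^bsub>grp ?P\<^esub> \<iota> l"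
        using K(1) by (auto simp: \<iota>_def ext_prod_simps group.is_monoid monoid.l_one intro!: restrict_ext)
    qed (use gP K(1)[OF i(1)] in auto)
    let ?S = "\<iota> ` carrier (grp (F i))"
    have S: "subgroup ?S (grp ?P)" using group_hom.img_is_subgroup[OF \<iota>] .
    have "(\<lambda>g. g i) ` ?S = carrier (grp (F i))" using i(1) by (simp add: \<iota>_def image_image)
    then have nofix: "\<not> has_fixed_point ?S ?P" using fp[OF S] i(1) by blast
    have "\<iota> \<in> epi (grp (F i)) ((grp ?P)\<lparr>carrier := ?S\<rparr>)"
      using \<iota> by (auto simp: epi_def group_hom_iff hom_def)
    then have "epi T ((grp ?P)\<lparr>carrier := ?S\<rparr>) \<noteq> {}" using i(2) epi_nonempty_trans by blast
    moreover have "epi ((grp ?P)\<lparr>carrier := ?S\<rparr>) (frattini_quotient ((grp ?P)\<lparr>carrier := ?S\<rparr>)) \<noteq> {}"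
      using frattini_coset_epi[OF group.subgroup_imp_group[OF gP S]] by blast
    ultimately have "epi T (frattini_quotient ((grp ?P)\<lparr>carrier := ?S\<rparr>)) \<noteq> {}"
      by (rule epi_nonempty_trans)
    then show ?thesis using S nofix unfolding covers_def by blast
  qed
qed

section \<open>Classification up to elementary equivalence\<close>

lemma admissible_rep_action:
  assumes "admissible M"
  shows "finite_gaction (rep_action M)"
    and "covers (rep_action M) T \<longleftrightarrow> (\<exists>K\<in>M. epi T K \<noteq> {})"
proof -
  have M: "finite M" "\<And>K. K \<in> M \<Longrightarrow> group K" "\<And>K. K \<in> M \<Longrightarrow> finite (carrier K)"
    "\<And>K. K \<in> M \<Longrightarrow> frattini K = {\<one>\<^bsub>K\<^esub>}"
    using assms by (simp_all add: admissible_def)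
  show "finite_gaction (rep_action M)"
    unfolding rep_action_def by (intro finite_gaction_ext_prod finite_gaction_prim_action M)
  show "covers (rep_action M) T \<longleftrightarrow> (\<exists>K\<in>M. epi T K \<noteq> {})"
    using covers_ext_prod_prim_action[OF M(1), of prim_action T] M
    by (simp add: rep_action_def prim_action_simps(1))
qed

lemma admissible_loop_set_action:
  assumes "admissible M"
  shows "finite_gaction (loop_set_action {prim_action K | K. K \<in> M})"
    and "covers (loop_set_action {prim_action K | K. K \<in> M}) T \<longleftrightarrow> (\<exists>K\<in>M. epi T K \<noteq> {})"
proof -
  let ?L = "{prim_action K | K. K \<in> M}"
  have M: "finite M" "\<And>K. K \<in> M \<Longrightarrow> group K" "\<And>K. K \<in> M \<Longrightarrow> finite (carrier K)"
    "\<And>K. K \<in> M \<Longrightarrow> frattini K = {\<one>\<^bsub>K\<^esub>}"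
    using assms by (simp_all add: admissible_def)
  have L: "?L = prim_action ` M" by blast
  have "finite ?L" unfolding L using M(1) by simp
  have grpL: "F = prim_action (grp F)" "grp F \<in> M" if "F \<in> ?L" for F
    using that by (auto simp: prim_action_simps(1))
  show "finite_gaction (loop_set_action ?L)"
    unfolding loop_set_action_def
    by (intro finite_gaction_ext_prod \<open>finite ?L\<close>)
      (use finite_gaction_prim_action M in auto)
  have "covers (loop_set_action ?L) T \<longleftrightarrow> (\<exists>F\<in>?L. epi T (grp F) \<noteq> {})"
    unfolding loop_set_action_def
    by (rule covers_ext_prod_prim_action[OF \<open>finite ?L\<close>]) (use grpL M in blast)+
  also have "\<dots> \<longleftrightarrow> (\<exists>K\<in>M. epi T K \<noteq> {})"
    unfolding L by (simp add: prim_action_simps(1))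
  finally show "covers (loop_set_action ?L) T \<longleftrightarrow> (\<exists>K\<in>M. epi T K \<noteq> {})" .
qed

text \<open>A group \<open>K\<close> in \<open>M\<close> is covered by both actions, so it maps onto some \<open>L\<close> in \<open>N\<close>, which in turn maps
  onto a group in \<open>M\<close>. By admissibility the latter is \<open>K\<close> again, and \<open>K\<close> and \<open>L\<close> are isomorphic.\<close>

lemma rep_action_elem_equiv_imp:
  fixes M N :: "'g monoid set"
  assumes M: "admissible M" and N: "admissible N"
    and eqv: "elem_equiv (rep_action M) (rep_action N)" and K: "K \<in> M"
  shows "\<exists>L\<in>N. K \<cong> L"
proof -
  note fin = admissible_rep_action(1)[OF M] admissible_rep_action(1)[OF N]
  note cov = admissible_rep_action(2)[OF M] admissible_rep_action(2)[OF N]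
  have cov_eq: "covers (rep_action M) T \<longleftrightarrow> covers (rep_action N) T" for T :: "'g monoid"
    using elem_implies_covers[OF fin] elem_implies_covers[OF fin(2,1)] eqv
    unfolding elem_equiv_def by blast
  have refl: "epi G G \<noteq> {}" for G :: "'g monoid" by (rule iso_imp_epi[OF iso_refl])
  have "covers (rep_action M) K" using cov(1) K refl by blast
  then obtain L where L: "L \<in> N" "epi K L \<noteq> {}" using cov(2) cov_eq by blast
  have "covers (rep_action N) L" using cov(2) L(1) refl by blast
  then obtain K' where K': "K' \<in> M" "epi L K' \<noteq> {}" using cov(1) cov_eq by blast
  have "epi K K' \<noteq> {}" using L(2) K'(2) by (rule epi_nonempty_trans)
  moreover have "K \<noteq> K' \<longrightarrow> epi K K' = {}" using M K K'(1) by (simp add: admissible_def)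
  ultimately have "K' = K" by blast
  obtain f where f: "f \<in> epi K L" using L(2) by blast
  have "finite (carrier K)" using M K by (simp add: admissible_def)
  then have "f \<in> iso K L"
    using epi_between_finite_imp_iso f K'(2) \<open>K' = K\<close> by blast
  then show ?thesis using L(1) is_isoI by blast
qed

lemma rep_action_elem_equiv_iff:
  fixes M N :: "'g monoid set"
  assumes M: "admissible M" and N: "admissible N"
  shows "elem_equiv (rep_action M) (rep_action N) \<longleftrightarrow> same_up_to_iso M N"
proof
  assume "elem_equiv (rep_action M) (rep_action N)"
  then show "same_up_to_iso M N"
    unfolding same_up_to_iso_def
    using rep_action_elem_equiv_imp[OF M N] rep_action_elem_equiv_imp[OF N M] elem_equiv_sym
    by metis
next
  assume same: "same_up_to_iso M N"
  have *: "\<exists>L\<in>N'. epi T L \<noteq> {}"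
    if "\<exists>K\<in>M'. epi T K \<noteq> {}" "\<forall>K\<in>M'. \<exists>L\<in>N'. K \<cong> L"
    for M' N' :: "'g monoid set" and T :: "('g monoid \<Rightarrow> 'g) monoid"
    using that iso_imp_epi epi_nonempty_trans by metis
  have "covers (rep_action M) T \<longleftrightarrow> covers (rep_action N) T" for T :: "('g monoid \<Rightarrow> 'g) monoid"
    unfolding admissible_rep_action(2)[OF M] admissible_rep_action(2)[OF N]
    using same *[of M T N] *[of N T M] unfolding same_up_to_iso_def by blast
  then show "elem_equiv (rep_action M) (rep_action N)"
    by (intro elem_equivI admissible_rep_action M N) simp_all
qed

lemma equiv_elem_equiv:
  "equiv {D :: ('g, 'x) gaction. finite_gaction D}
     {(D, E). finite_gaction D \<and> finite_gaction E \<and> elem_equiv D E}"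
proof (rule equivI)
  show "sym {(D, E). finite_gaction D \<and> finite_gaction E \<and> elem_equiv D E}"
    by (auto simp: sym_def intro: elem_equiv_sym)
  show "trans {(D, E). finite_gaction D \<and> finite_gaction E \<and> elem_equiv D E}"
    by (auto simp: trans_def intro: elem_equiv_trans)
qed (auto simp: refl_on_def intro: elem_equiv_refl)

theorem theorem5p31:
  fixes A :: "('a, 'b) gaction" and B :: "('c, 'd) gaction" and C :: "('e, 'f) gaction"
  assumes "finite_gaction A" and "finite_gaction B" and "finite_gaction C"
  shows "equiv {D :: ('a, 'b) gaction. finite_gaction D}
           {(D, E). finite_gaction D \<and> finite_gaction E \<and> elem_equiv D E} \<and>
         (elem_equiv A B \<longrightarrow> elem_equiv B A) \<and>
         (elem_equiv A B \<longrightarrow> elem_equiv B C \<longrightarrow> elem_equiv A C) \<and>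
         (chi_r B = chi_r A \<longrightarrow> elem_equiv A B) \<and>
         (\<forall>M :: nat monoid set. admissible M \<longrightarrow> finite_gaction (rep_action M)) \<and>
         (\<exists>M :: nat monoid set. admissible M \<and> elem_equiv A (rep_action M)) \<and>
         (\<forall>M N :: nat monoid set. admissible M \<longrightarrow> admissible N \<longrightarrow>
            (elem_equiv (rep_action M) (rep_action N) \<longleftrightarrow> same_up_to_iso M N)) \<and>
         (\<exists>M. iso_reps (chi_r A) M) \<and>
         (\<forall>M. iso_reps (chi_r A) M \<longrightarrow>
            admissible M \<and>
            elem_equiv A (rep_action M) \<and>
            elem_equiv A (loop_set_action {prim_action K | K. K \<in> M}))"
proof -
  have chi: "elem_equiv A B" if "chi_r B = chi_r A"
    by (rule elem_equivI[OF assms(1,2)])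
      (simp_all add: covers_iff_chi_r[OF assms(1)] covers_iff_chi_r[OF assms(2)] that)
  have reps: "admissible M \<and> elem_equiv A (rep_action M) \<and>
      elem_equiv A (loop_set_action {prim_action K | K. K \<in> M})" if M: "iso_reps (chi_r A) M" for M
  proof (intro conjI)
    show adm: "admissible M" using admissible_iso_reps[OF assms(1) M] .
    show "elem_equiv A (rep_action M)"
      by (rule elem_equivI[OF assms(1) admissible_rep_action(1)[OF adm]])
        (simp_all add: covers_iff_iso_reps[OF assms(1) M] admissible_rep_action(2)[OF adm])
    show "elem_equiv A (loop_set_action {prim_action K | K. K \<in> M})"
      by (rule elem_equivI[OF assms(1) admissible_loop_set_action(1)[OF adm]])
        (simp_all only: covers_iff_iso_reps[OF assms(1) M] admissible_loop_set_action(2)[OF adm])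
  qed
  have ex: "\<exists>M. iso_reps (chi_r A) M" using iso_reps_chi_r_exists[OF assms(1)] .
  then have rep: "\<exists>M :: nat monoid set. admissible M \<and> elem_equiv A (rep_action M)"
    using reps by blast
  have fin: "\<forall>M :: nat monoid set. admissible M \<longrightarrow> finite_gaction (rep_action M)"
    using admissible_rep_action(1) by blast
  have unique: "\<forall>M N :: nat monoid set. admissible M \<longrightarrow> admissible N \<longrightarrow>
      (elem_equiv (rep_action M) (rep_action N) \<longleftrightarrow> same_up_to_iso M N)"
    using rep_action_elem_equiv_iff by blast
  show ?thesis
    using equiv_elem_equiv elem_equiv_sym[of A B] elem_equiv_trans[OF assms] chi fin rep unique ex
      reps by (intro conjI allI impI) simp_all
qed

end
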